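(* Let $k\ge 1$ and let $M$ be an $MC^k$-Fréchet manifold modelled on a Fréchet space $F$. Then the tangent bundle $TM$, with its natural projection $\pi_M: TM\to M$, admits a vector bundle structure over $M$ with fiber of type $F$.
   Context: **Metrics and Lipschitz linear maps.** A Fréchet space $(F,d)$ is a Fréchet space whose topology is defined by a complete translation-invariant metric $d$ with absolutely convex balls (a *standard metric* ); all Fréchet spaces carry a fixed standard metric, and finite products carry the maximum metric. Put $\|f\|_d:=d(f,0)$. For Fréchet spaces $(E,g)$, $(F,d)$, let $\mathcal L_{g,d}(E,F)$ be the set of linear maps $L:E\to F$ with $\|L\|_{g,d}:=\sup_{x\in E\setminus\{0\}}\|L x\|_d/\|x\|_g<\infty$, with the translation-invariant metric $D_{g,d}(L,H)=\|L-H\|_{g,d}$, which makes it an abelian topological group. Let $\mathcal L_{g,d}(E,F)_0$ be the connected component of $0$; with this metric it is a Fréchet space. **$MC^k$-maps.** Let $U\subseteq E$ be open and $P:U\to F$ continuous. $P$ is differentiable at $p$ if there is a linear map $\mathrm dP(p):E\to F$ with $\mathrm dP(p)h=\lim_{t\to0}(P(p+th)-P(p))/t$ for all $h\in E$. $P$ is Keller-differentiable if it is differentiable at all $p\in U$, each $\mathrm dP(p)$ is continuous, $p\mapsto \mathrm dP(p)$ is continuous into the space $CL(E,F)$ of continuous linear maps with the compact-open topology, and $U\times E\to F$, $(u,h)\mapsto \mathrm dP(u)h$, is continuous. $P$ is b-differentiable if it is Keller-differentiable, $\mathrm dP(p)\in\mathcal L_{g,d}(E,F)$ for all $p\in U$,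 and $P':U\to\mathcal L_{g,d}(E,F)$, $p\mapsto \mathrm dP(p)$, is continuous. $P$ is $MC^0$ if continuous, and $MC^1$ if b-differentiable. For $k\ge2$, $P$ is $MC^k$ if it is $MC^1$ and each $x_0\in U$ has a connected open neighborhood $V\subseteq U$ such that $P'|_V-P'(x_0):V\to\mathcal L_{g,d}(E,F)_0$ is $MC^{k-1}$. $P$ is $MC^\infty$ if it is $MC^k$ for all $k$. **Manifolds.** An $MC^k$-Fréchet manifold modelled on $F$ is a Hausdorff second countable space with an atlas $\{(U_\alpha,\varphi_\alpha)\}$ of charts with values in $F$ whose transition functions are $MC^k$. **Tangent bundle.** For $p\in M$ let $\mathcal{MC}_p(M)$ be the set of all $MC^\infty$-mappings $f:\mathbb R\to M$ with $f(0)=p$ (of class $MC^k$ if $M$ is only of class $MC^k$). Two such $f,g$ are equivalent if $(\varphi_\alpha\circ f)'(0)=(\varphi_\alpha\circ g)'(0)$ for a chart $\varphi_\alpha$ at $p$; the class of $f$ is its 1-jet $j^1_pf$. $TM$ is the set of all 1-jets at all points of $M$, $\pi_M(j^1_pf)=p$, and $T_pM=\pi_M^{-1}(p)$. $TM$ carries the charts $T\varphi_\alpha:\pi_M^{-1}(U_\alpha)\to\varphi_\alpha(U_\alpha)\times F$, $j^1_pf\mapsto(\varphi_\alpha(p),(\varphi_\alpha\circ f)'(0))$. **Vector bundles.** An $MC^r$-vector bundle of type $E$ ($E$ a Fréchet space) over $M$ consists of an $MC^r$-manifold $V$ and an $MC^r$-map $\Pi:V\to M$ such that: (VB.1) for every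 $m\in M$ the fiber $V_m=\Pi^{-1}(m)$ is a Fréchet space isomorphic to $E$; (VB.2) each $m\in M$ has an open neighborhood $U$ for which there is a diffeomorphism $\phi_U:\Pi^{-1}(U)\to U\times E$ of the form $\phi_U=(\Pi|_{\Pi^{-1}(U)},\psi_U)$ with $\psi_U:\Pi^{-1}(U)\to E$ linear on each $V_m$, $m\in U$. Writing $\phi_U\circ\phi_V^{-1}(x,v)=(x,\psi_{UV}(x)v)$ on $(U\cap V)\times E$, the maps $\psi_{UV}:U\cap V\to \mathrm{GL}(E)$ are of class $MC^r$ in the sense that $(x,v)\mapsto(\psi_{UV}(x)v,\psi_{UV}(x)^{-1}v)$ is of class $MC^r$. In the claim, "vector bundle structure" means an $MC^r$-vector bundle for some $r\ge 0$, for the manifold structure on $TM$ given by the charts $T\varphi_\alpha$.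
   Formalization: It is assumed in addition that each chart Tφ maps onto φ(U)×F, i.e. every vector of F is the velocity of a curve; this can fail for standard metrics (F=ℝ, d=√|x−y|), is necessary for the claim, and for nonempty M forces F to be normable. *)

theory Defs
  imports
    "HOL-Analysis.Analysis"
    "HOL-Library.Function_Algebras"
    "HOL-Library.Extended_Nat"
begin

section \<open>Frechet spaces with a standard metric\<close>

text \<open>
  Topologies are induced by explicit metrics (type \<^typ>\<open>'a metric\<close>), never by type classes: the
  classes of maps below depend on the metric and not only on the topology.

  The predicate \<open>frechet_on\<close> takes the vector space operations as parameters because it is also used
  for the fibers of a bundle, which are not types.
\<close>

definition vector_space_ops ::
    "'v set \<Rightarrow> ('v \<Rightarrow> 'v \<Rightarrow> 'v) \<Rightarrow> 'v \<Rightarrow> (real \<Rightarrow> 'v \<Rightarrow> 'v) \<Rightarrow> bool" where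
  "vector_space_ops S add z smul \<longleftrightarrow>
     z \<in> S \<and>
     (\<forall>x\<in>S. \<forall>y\<in>S. add x y \<in> S \<and> add x y = add y x) \<and>
     (\<forall>x\<in>S. \<forall>y\<in>S. \<forall>w\<in>S. add (add x y) w = add x (add y w)) \<and>
     (\<forall>x\<in>S. add z x = x) \<and>
     (\<forall>x\<in>S. \<exists>y\<in>S. add x y = z) \<and>
     (\<forall>a. \<forall>x\<in>S. smul a x \<in> S) \<and>
     (\<forall>a. \<forall>x\<in>S. \<forall>y\<in>S. smul a (add x y) = add (smul a x) (smul a y)) \<and>
     (\<forall>a b. \<forall>x\<in>S. smul (a + b) x = add (smul a x) (smul b x)) \<and>
     (\<forall>a b. \<forall>x\<in>S. smul a (smul b x) = smul (a * b) x) \<and>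
     (\<forall>x\<in>S. smul 1 x = x)"

definition frechet_on ::
    "('v \<Rightarrow> 'v \<Rightarrow> 'v) \<Rightarrow> 'v \<Rightarrow> (real \<Rightarrow> 'v \<Rightarrow> 'v) \<Rightarrow> 'v metric \<Rightarrow> bool" where
  "frechet_on add z smul m \<longleftrightarrow>
     vector_space_ops (mspace m) add z smul \<and>
     mcomplete_of m \<and>
     (\<forall>x\<in>mspace m. \<forall>y\<in>mspace m. \<forall>w\<in>mspace m. mdist m (add x w) (add y w) = mdist m x y) \<and>
     (\<forall>r>0. \<forall>x\<in>mspace m. \<forall>y\<in>mspace m. \<forall>a b. mdist m x z < r \<and> mdist m y z < r \<and> \<bar>a\<bar> + \<bar>b\<bar> \<le> 1
        \<longrightarrow> mdist m (add (smul a x) (smul b y)) z < r) \<and>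
     continuous_map (prod_topology euclideanreal (mtopology_of m)) (mtopology_of m)
       (\<lambda>(a, x). smul a x)"

definition frechet :: "'f::real_vector metric \<Rightarrow> bool" where
  "frechet F \<longleftrightarrow> mspace F = UNIV \<and> frechet_on (+) 0 (*\<^sub>R) F"

definition max_metric :: "'a metric \<Rightarrow> 'b metric \<Rightarrow> ('a \<times> 'b) metric" where
  "max_metric A B =
     metric (mspace A \<times> mspace B, \<lambda>(x, y) (x', y'). max (mdist A x x') (mdist B y y'))"

section \<open>Lipschitz linear maps\<close>

text \<open>
  The domain \<open>E\<close> always has carrier \<^const>\<open>UNIV\<close>; the codomain \<open>G\<close> may have a proper subspace of
  its type as carrier.
\<close>

definition lip_maps ::
    "'e::real_vector metric \<Rightarrow> 'v::real_vector metric \<Rightarrow> ('e \<Rightarrow> 'v) set" where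
  "lip_maps E G =
     {L. linear L \<and> range L \<subseteq> mspace G \<and>
         bdd_above {mdist G (L x) 0 / mdist E x 0 | x. x \<noteq> 0}}"

(* The inserted 0 only matters for E = {0}, where the supremum is over the empty set. *)
definition lip_norm ::
    "'e::real_vector metric \<Rightarrow> 'v::real_vector metric \<Rightarrow> ('e \<Rightarrow> 'v) \<Rightarrow> real" where
  "lip_norm E G L = Sup (insert 0 {mdist G (L x) 0 / mdist E x 0 | x. x \<noteq> 0})"

(* The value 0 outside the carrier is needed because Metric_space requires nonnegativity and symmetry
   for all arguments. *)
definition lip_metric ::
    "'e::real_vector metric \<Rightarrow> 'v::real_vector metric \<Rightarrow> ('e \<Rightarrow> 'v) metric" where
  "lip_metric E G =
     metric (lip_maps E G,
             \<lambda>L H. if L \<in> lip_maps E G \<and> H \<in> lip_maps E G then lip_norm E G (\<lambda>x. L x - H x) else 0)"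

definition lip_component ::
    "'e::real_vector metric \<Rightarrow> 'v::real_vector metric \<Rightarrow> ('e \<Rightarrow> 'v) set" where
  "lip_component E G = connected_component_of_set (mtopology_of (lip_metric E G)) (\<lambda>x. 0)"

section \<open>b-differentiable maps\<close>

definition dir_deriv ::
    "'v::real_vector metric \<Rightarrow> ('e::real_vector \<Rightarrow> 'v) \<Rightarrow> 'e \<Rightarrow> 'e \<Rightarrow> 'v" where
  "dir_deriv G P p h =
     (THE y. limitin (mtopology_of G) (\<lambda>t. (P (p + t *\<^sub>R h) - P p) /\<^sub>R t) y (at 0))"

definition differentiable_pt ::
    "'v::real_vector metric \<Rightarrow> ('e::real_vector \<Rightarrow> 'v) \<Rightarrow> 'e \<Rightarrow> bool" where
  "differentiable_pt G P p \<longleftrightarrow>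
     linear (dir_deriv G P p) \<and>
     (\<forall>h. limitin (mtopology_of G) (\<lambda>t. (P (p + t *\<^sub>R h) - P p) /\<^sub>R t) (dir_deriv G P p h) (at 0))"

definition cont_linear ::
    "'e::real_vector metric \<Rightarrow> 'v::real_vector metric \<Rightarrow> ('e \<Rightarrow> 'v) set" where
  "cont_linear E G = {L. linear L \<and> continuous_map (mtopology_of E) (mtopology_of G) L}"

definition compact_open_topology ::
    "'e::real_vector metric \<Rightarrow> 'v::real_vector metric \<Rightarrow> ('e \<Rightarrow> 'v) topology" where
  "compact_open_topology E G =
     topology_generated_by
       {{L \<in> cont_linear E G. L ` K \<subseteq> W} | K W.
          compactin (mtopology_of E) K \<and> openin (mtopology_of G) W}"

definition cont_on ::
    "'e metric \<Rightarrow> 'v metric \<Rightarrow> 'e set \<Rightarrow> ('e \<Rightarrow> 'v) \<Rightarrow> bool" where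
  "cont_on E G U P \<longleftrightarrow> continuous_map (subtopology (mtopology_of E) U) (mtopology_of G) P"

definition keller_differentiable ::
    "'e::real_vector metric \<Rightarrow> 'v::real_vector metric \<Rightarrow> 'e set \<Rightarrow> ('e \<Rightarrow> 'v) \<Rightarrow> bool" where
  "keller_differentiable E G U P \<longleftrightarrow>
     cont_on E G U P \<and>
     (\<forall>p\<in>U. differentiable_pt G P p) \<and>
     (\<forall>p\<in>U. continuous_map (mtopology_of E) (mtopology_of G) (dir_deriv G P p)) \<and>
     continuous_map (subtopology (mtopology_of E) U) (compact_open_topology E G) (dir_deriv G P) \<and>
     continuous_map (prod_topology (subtopology (mtopology_of E) U) (mtopology_of E))
       (mtopology_of G) (\<lambda>(u, h). dir_deriv G P u h)"

definition b_differentiable ::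
    "'e::real_vector metric \<Rightarrow> 'v::real_vector metric \<Rightarrow> 'e set \<Rightarrow> ('e \<Rightarrow> 'v) \<Rightarrow> bool" where
  "b_differentiable E G U P \<longleftrightarrow>
     keller_differentiable E G U P \<and>
     (\<forall>p\<in>U. dir_deriv G P p \<in> lip_maps E G) \<and>
     continuous_map (subtopology (mtopology_of E) U) (mtopology_of (lip_metric E G))
       (dir_deriv G P)"

section \<open>\<open>MC\<^sup>k\<close>-maps\<close>

text \<open>
  The recursion for \<open>MC\<^sup>k\<close> replaces a codomain \<open>G\<close> by the component of \<open>0\<close> in the space of Lipschitz
  linear maps \<open>E \<Rightarrow> G\<close>. To keep the iterated codomains \<open>E \<Rightarrow> F\<close>, \<open>E \<Rightarrow> (E \<Rightarrow> F)\<close>, ... inside one type,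
  they are identified isometrically with spaces of functions \<open>'e list \<Rightarrow> 'f\<close> by uncurrying: a linear
  map \<open>L\<close> into \<open>F\<close> corresponds to \<open>[h] \<mapsto> L h\<close>, and a linear map \<open>L\<close> into a later space to
  \<open>h # hs \<mapsto> L h hs\<close>. The functions in the \<open>n\<close>-th space vanish on lists of length different from \<open>n\<close>.
  The vector space structure is pointwise.
\<close>

instantiation "fun" :: (type, real_vector) real_vector
begin

definition "scaleR r f = (\<lambda>x. r *\<^sub>R f x)"

instance
  by standard (simp_all add: scaleR_fun_def fun_eq_iff algebra_simps)

end

definition uncurry1 :: "('e \<Rightarrow> 'f::real_vector) \<Rightarrow> 'e list \<Rightarrow> 'f" where
  "uncurry1 L = (\<lambda>hs. case hs of [h] \<Rightarrow> L h | _ \<Rightarrow> 0)"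

definition curry1 :: "('e list \<Rightarrow> 'f::real_vector) \<Rightarrow> 'e \<Rightarrow> 'f" where
  "curry1 A = (\<lambda>h. A [h])"

definition first_stage ::
    "'e::real_vector metric \<Rightarrow> 'f::real_vector metric \<Rightarrow> ('e list \<Rightarrow> 'f) metric" where
  "first_stage E F =
     metric (uncurry1 ` lip_component E F, \<lambda>A B. mdist (lip_metric E F) (curry1 A) (curry1 B))"

definition uncurry_stage :: "('e \<Rightarrow> 'e list \<Rightarrow> 'f::real_vector) \<Rightarrow> 'e list \<Rightarrow> 'f" where
  "uncurry_stage L = (\<lambda>hs. case hs of [] \<Rightarrow> 0 | h # hs' \<Rightarrow> L h hs')"

definition curry_stage :: "('e list \<Rightarrow> 'f::real_vector) \<Rightarrow> 'e \<Rightarrow> 'e list \<Rightarrow> 'f" where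
  "curry_stage A = (\<lambda>h hs. A (h # hs))"

definition next_stage ::
    "'e::real_vector metric \<Rightarrow> ('e list \<Rightarrow> 'f::real_vector) metric \<Rightarrow> ('e list \<Rightarrow> 'f) metric" where
  "next_stage E G =
     metric (uncurry_stage ` lip_component E G,
             \<lambda>A B. mdist (lip_metric E G) (curry_stage A) (curry_stage B))"

(* One step of the recursion; Q V R stands for: R is of the lower class on V. *)
definition MC_step ::
    "'e::real_vector metric \<Rightarrow> 'v::real_vector metric \<Rightarrow> 'e set \<Rightarrow> ('e \<Rightarrow> 'v)
      \<Rightarrow> ('e set \<Rightarrow> ('e \<Rightarrow> 'e \<Rightarrow> 'v) \<Rightarrow> bool) \<Rightarrow> bool" where
  "MC_step E G U P Q \<longleftrightarrow>
     b_differentiable E G U P \<and>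
     (\<forall>x0\<in>U. \<exists>V. openin (mtopology_of E) V \<and> connectedin (mtopology_of E) V \<and> x0 \<in> V \<and> V \<subseteq> U \<and>
        Q V (\<lambda>x h. dir_deriv G P x h - dir_deriv G P x0 h))"

fun MC_stage ::
    "nat \<Rightarrow> 'e::real_vector metric \<Rightarrow> ('e list \<Rightarrow> 'f::real_vector) metric \<Rightarrow> 'e set
      \<Rightarrow> ('e \<Rightarrow> 'e list \<Rightarrow> 'f) \<Rightarrow> bool" where
  "MC_stage 0 E G U P \<longleftrightarrow> cont_on E G U P"
| "MC_stage (Suc 0) E G U P \<longleftrightarrow> b_differentiable E G U P"
| "MC_stage (Suc (Suc k)) E G U P \<longleftrightarrow>
     MC_step E G U P (\<lambda>V R. MC_stage (Suc k) E (next_stage E G) V (\<lambda>x. uncurry_stage (R x)))"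

fun MC_nat ::
    "nat \<Rightarrow> 'e::real_vector metric \<Rightarrow> 'f::real_vector metric \<Rightarrow> 'e set \<Rightarrow> ('e \<Rightarrow> 'f) \<Rightarrow> bool" where
  "MC_nat 0 E F U P \<longleftrightarrow> cont_on E F U P"
| "MC_nat (Suc 0) E F U P \<longleftrightarrow> b_differentiable E F U P"
| "MC_nat (Suc (Suc k)) E F U P \<longleftrightarrow>
     MC_step E F U P (\<lambda>V R. MC_stage (Suc k) E (first_stage E F) V (\<lambda>x. uncurry1 (R x)))"

definition MC_on ::
    "enat \<Rightarrow> 'e::real_vector metric \<Rightarrow> 'f::real_vector metric \<Rightarrow> 'e set \<Rightarrow> ('e \<Rightarrow> 'f) \<Rightarrow> bool" where
  "MC_on k E F U P \<longleftrightarrow>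
     (case k of enat n \<Rightarrow> MC_nat n E F U P | \<infinity> \<Rightarrow> (\<forall>n. MC_nat n E F U P))"

section \<open>\<open>MC\<^sup>k\<close>-manifolds\<close>

record ('m, 'f) mfld =
  model :: "'f metric"
  mtop :: "'m topology"
  charts :: "('m set \<times> ('m \<Rightarrow> 'f)) set"

definition MC_manifold :: "enat \<Rightarrow> ('m, 'f::real_vector) mfld \<Rightarrow> bool" where
  "MC_manifold k M \<longleftrightarrow>
     frechet (model M) \<and>
     Hausdorff_space (mtop M) \<and> second_countable (mtop M) \<and>
     (\<Union>(U, \<phi>)\<in>charts M. U) = topspace (mtop M) \<and>
     (\<forall>(U, \<phi>)\<in>charts M.
        openin (mtop M) U \<and> openin (mtopology_of (model M)) (\<phi> ` U) \<and>
        homeomorphic_map (subtopology (mtop M) U) (subtopology (mtopology_of (model M)) (\<phi> ` U)) \<phi>) \<and>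
     (\<forall>(U, \<phi>)\<in>charts M. \<forall>(V, \<psi>)\<in>charts M.
        MC_on k (model M) (model M) (\<phi> ` (U \<inter> V)) (\<psi> \<circ> inv_into U \<phi>))"

definition MC_map ::
    "enat \<Rightarrow> ('m, 'e::real_vector) mfld \<Rightarrow> ('n, 'f::real_vector) mfld \<Rightarrow> ('m \<Rightarrow> 'n) \<Rightarrow> bool" where
  "MC_map k M N f \<longleftrightarrow>
     continuous_map (mtop M) (mtop N) f \<and>
     (\<forall>(U, \<phi>)\<in>charts M. \<forall>(V, \<psi>)\<in>charts N.
        MC_on k (model M) (model N) (\<phi> ` (U \<inter> f -` V)) (\<psi> \<circ> f \<circ> inv_into U \<phi>))"

definition MC_diffeo ::
    "enat \<Rightarrow> ('m, 'e::real_vector) mfld \<Rightarrow> ('n, 'f::real_vector) mfld \<Rightarrow> ('m \<Rightarrow> 'n) \<Rightarrow> bool" where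
  "MC_diffeo k M N f \<longleftrightarrow>
     MC_map k M N f \<and>
     (\<exists>g. MC_map k N M g \<and>
        (\<forall>x\<in>topspace (mtop M). g (f x) = x) \<and> (\<forall>y\<in>topspace (mtop N). f (g y) = y))"

definition vec_mfld :: "'f metric \<Rightarrow> ('f, 'f) mfld" where
  "vec_mfld F = \<lparr>model = F, mtop = mtopology_of F, charts = {(UNIV, \<lambda>x. x)}\<rparr>"

definition open_submfld :: "('m, 'f) mfld \<Rightarrow> 'm set \<Rightarrow> ('m, 'f) mfld" where
  "open_submfld M W =
     \<lparr>model = model M, mtop = subtopology (mtop M) W,
      charts = (\<lambda>(U, \<phi>). (U \<inter> W, \<phi>)) ` charts M\<rparr>"

definition times_mfld :: "('m, 'f) mfld \<Rightarrow> 'e metric \<Rightarrow> ('m \<times> 'e, 'f \<times> 'e) mfld" where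
  "times_mfld M E =
     \<lparr>model = max_metric (model M) E, mtop = prod_topology (mtop M) (mtopology_of E),
      charts = (\<lambda>(U, \<phi>). (U \<times> UNIV, \<lambda>(x, v). (\<phi> x, v))) ` charts M\<rparr>"

section \<open>The tangent bundle\<close>

definition curves_at :: "enat \<Rightarrow> ('m, 'f::real_vector) mfld \<Rightarrow> 'm \<Rightarrow> (real \<Rightarrow> 'm) set" where
  "curves_at k M p = {f. MC_map k (vec_mfld euclidean_metric) M f \<and> f 0 = p}"

definition velocity :: "('m, 'f::real_vector) mfld \<Rightarrow> ('m \<Rightarrow> 'f) \<Rightarrow> (real \<Rightarrow> 'm) \<Rightarrow> 'f" where
  "velocity M \<phi> f = dir_deriv (model M) (\<phi> \<circ> f) 0 1"

definition jet ::
    "enat \<Rightarrow> ('m, 'f::real_vector) mfld \<Rightarrow> 'm \<Rightarrow> (real \<Rightarrow> 'm) \<Rightarrow> (real \<Rightarrow> 'm) set" where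
  "jet k M p f =
     {g \<in> curves_at k M p. \<exists>(U, \<phi>)\<in>charts M. p \<in> U \<and> velocity M \<phi> f = velocity M \<phi> g}"

definition tangent_set :: "enat \<Rightarrow> ('m, 'f::real_vector) mfld \<Rightarrow> (real \<Rightarrow> 'm) set set" where
  "tangent_set k M = (\<Union>p\<in>topspace (mtop M). jet k M p ` curves_at k M p)"

(* All curves in a 1-jet have the same value at 0, which is its base point. *)
definition tangent_proj :: "(real \<Rightarrow> 'm) set \<Rightarrow> 'm" where
  "tangent_proj j = (THE p. \<exists>f\<in>j. f 0 = p)"

definition tangent_over :: "enat \<Rightarrow> ('m, 'f::real_vector) mfld \<Rightarrow> 'm set \<Rightarrow> (real \<Rightarrow> 'm) set set" where
  "tangent_over k M U = {j \<in> tangent_set k M. tangent_proj j \<in> U}"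

definition tangent_chart ::
    "('m, 'f::real_vector) mfld \<Rightarrow> ('m \<Rightarrow> 'f) \<Rightarrow> (real \<Rightarrow> 'm) set \<Rightarrow> 'f \<times> 'f" where
  "tangent_chart M \<phi> j = (\<phi> (tangent_proj j), velocity M \<phi> (SOME f. f \<in> j))"

definition tangent_mfld ::
    "enat \<Rightarrow> ('m, 'f::real_vector) mfld \<Rightarrow> ((real \<Rightarrow> 'm) set, 'f \<times> 'f) mfld" where
  "tangent_mfld k M =
     \<lparr>model = max_metric (model M) (model M),
      mtop = topology_generated_by
        {{j \<in> tangent_over k M U. tangent_chart M \<phi> j \<in> W} | U \<phi> W.
           (U, \<phi>) \<in> charts M \<and> openin (mtopology_of (max_metric (model M) (model M))) W},
      charts = (\<lambda>(U, \<phi>). (tangent_over k M U, tangent_chart M \<phi>)) ` charts M\<rparr>"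

text \<open>
  That \<open>T\<phi>\<close> takes values onto \<open>\<phi>(U) \<times> F\<close> is part of the notion of the tangent bundle with its charts
  and does not follow from the other conditions: every velocity \<open>v\<close> of a curve satisfies
  \<open>\<parallel>t v\<parallel>\<^sub>d \<le> C \<bar>t\<bar>\<close>, because the derivative of the curve is a Lipschitz linear map on the real line.
  For instance, all velocities vanish for \<open>F = \<real>\<close> with the standard metric \<open>\<surd>\<bar>x - y\<bar>\<close>.
\<close>

definition has_tangent_charts :: "enat \<Rightarrow> ('m, 'f::real_vector) mfld \<Rightarrow> bool" where
  "has_tangent_charts k M \<longleftrightarrow>
     (\<forall>(U, \<phi>)\<in>charts M. tangent_chart M \<phi> ` tangent_over k M U = \<phi> ` U \<times> UNIV)"

section \<open>Vector bundles\<close>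

definition fiber :: "('v, 'w) mfld \<Rightarrow> ('v \<Rightarrow> 'm) \<Rightarrow> 'm \<Rightarrow> 'v set" where
  "fiber V \<pi> m = {v \<in> topspace (mtop V). \<pi> v = m}"

definition linear_between ::
    "'v set \<Rightarrow> ('v \<Rightarrow> 'v \<Rightarrow> 'v) \<Rightarrow> (real \<Rightarrow> 'v \<Rightarrow> 'v) \<Rightarrow> ('v \<Rightarrow> 'e::real_vector) \<Rightarrow> bool" where
  "linear_between S add smul \<psi> \<longleftrightarrow>
     (\<forall>v\<in>S. \<forall>w\<in>S. \<psi> (add v w) = \<psi> v + \<psi> w) \<and> (\<forall>a. \<forall>v\<in>S. \<psi> (smul a v) = a *\<^sub>R \<psi> v)"

definition GL :: "'e::real_vector metric \<Rightarrow> ('e \<Rightarrow> 'e) set" where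
  "GL E = {L. linear L \<and> homeomorphic_map (mtopology_of E) (mtopology_of E) L}"

(* The second component of the change of trivialization (\<pi>, \<psi>) o (\<pi>, \<psi>')^-1 at (x, v). *)
definition transition ::
    "('v, 'w) mfld \<Rightarrow> ('v \<Rightarrow> 'm) \<Rightarrow> ('v \<Rightarrow> 'e) \<Rightarrow> ('v \<Rightarrow> 'e) \<Rightarrow> 'm \<Rightarrow> 'e \<Rightarrow> 'e" where
  "transition V \<pi> \<psi> \<psi>' x v = \<psi> (inv_into (fiber V \<pi> x) \<psi>' v)"

text \<open>
  The linear structure of the fibers is given by \<open>add\<close> and \<open>smul\<close>, which are meaningful only for
  arguments in a common fiber. The set \<open>T\<close> consists of the pairs \<open>(U, \<psi>\<^sub>U)\<close> of the chosen local
  trivializations \<open>(\<pi>, \<psi>\<^sub>U)\<close>. The topology of a fiber is the one induced from the total space.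
\<close>

definition MC_vector_bundle ::
    "enat \<Rightarrow> ('m, 'f::real_vector) mfld \<Rightarrow> ('v, 'w::real_vector) mfld \<Rightarrow> ('v \<Rightarrow> 'm)
      \<Rightarrow> 'e::real_vector metric \<Rightarrow> ('v \<Rightarrow> 'v \<Rightarrow> 'v) \<Rightarrow> (real \<Rightarrow> 'v \<Rightarrow> 'v) \<Rightarrow> ('m set \<times> ('v \<Rightarrow> 'e)) set
      \<Rightarrow> bool" where
  "MC_vector_bundle r M V \<pi> E add smul T \<longleftrightarrow>
     frechet E \<and> MC_manifold r M \<and> MC_manifold r V \<and> MC_map r V M \<pi> \<and>
     (\<forall>m\<in>topspace (mtop M). \<exists>z \<rho>.
        frechet_on add z smul \<rho> \<and>
        mtopology_of \<rho> = subtopology (mtop V) (fiber V \<pi> m) \<and>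
        (\<exists>\<psi>. linear_between (fiber V \<pi> m) add smul \<psi> \<and>
             homeomorphic_map (mtopology_of \<rho>) (mtopology_of E) \<psi>)) \<and>
     (\<forall>m\<in>topspace (mtop M). \<exists>(U, \<psi>)\<in>T. m \<in> U) \<and>
     (\<forall>(U, \<psi>)\<in>T.
        openin (mtop M) U \<and>
        MC_diffeo r (open_submfld V {v \<in> topspace (mtop V). \<pi> v \<in> U})
          (times_mfld (open_submfld M U) E) (\<lambda>v. (\<pi> v, \<psi> v)) \<and>
        (\<forall>m\<in>U. linear_between (fiber V \<pi> m) add smul \<psi>)) \<and>
     (\<forall>(U, \<psi>)\<in>T. \<forall>(U', \<psi>')\<in>T.
        (\<forall>x\<in>U \<inter> U'. transition V \<pi> \<psi> \<psi>' x \<in> GL E) \<and>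
        MC_map r (times_mfld (open_submfld M (U \<inter> U')) E) (vec_mfld (max_metric E E))
          (\<lambda>(x, v). (transition V \<pi> \<psi> \<psi>' x v, inv (transition V \<pi> \<psi> \<psi>' x) v)))"

end

theory Submission
  imports Defs
begin

text \<open>
  The charts \<open>T\<phi>\<close> of the tangent bundle already look like local trivializations: in a chart \<open>\<phi>\<close> a
  1-jet is a base point together with the velocity of a representing curve. Two such descriptions are
  related by \<open>(x, v) \<mapsto> (P x, dP(x) v)\<close>, where \<open>P\<close> is the coordinate change, so everything follows
  from two properties of this map: it is linear in \<open>v\<close>, and it is jointly continuous.

  The bundle is constructed for the class \<open>r = 0\<close>. For \<open>k = 1\<close> the derivative of a coordinate change
  is only known to be continuous, and class \<open>0\<close> reduces every smoothness requirement to continuity of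
  the maps in charts.

  The analytic core is the chain rule for a differentiable curve and a Keller-differentiable map
  (\<open>chain_rule_curve\<close>). It rests on a mean value estimate with values in open convex sets
  (\<open>increment_in_convex\<close>); such sets form neighbourhood bases because the balls of a standard metric
  are absolutely convex. The chain rule gives \<open>velocity_change\<close>, hence the independence of 1-jets of the chart, the transition maps of the
  charts \<open>T\<phi>\<close>, and the independence of the chart of the addition and scaling of tangent vectors.

  The rest is topology. Compatible charts generate a topology in which each of them is a homeomorphism
  (\<open>topology_generated_by_charts\<close>). The Hausdorff property is inherited from the base and from the
  model. For second countability, a nonempty chart domain makes an open subset of the model second
  countable, and countably many dilated copies of it exhaust the model (\<open>second_countable_frechet\<close>).
  Finally, each fiber is identified with the model by its velocity coordinate, along which the Frechet
  structure is pulled back (\<open>frechet_on_transport\<close>).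
\<close>

section \<open>Curves and directional derivatives in Frechet spaces\<close>

lemma frechetD:
  assumes "frechet F"
  shows mspace_frechet: "mspace F = UNIV"
    and mcomplete_frechet: "mcomplete_of F"
    and mdist_translate: "mdist F (x + w) (y + w) = mdist F x y"
    and mdist_absconvex: "\<lbrakk>mdist F x 0 < r; mdist F y 0 < r; \<bar>a\<bar> + \<bar>b\<bar> \<le> 1\<rbrakk>
      \<Longrightarrow> mdist F (a *\<^sub>R x + b *\<^sub>R y) 0 < r"
    and continuous_scaleR: "continuous_map (prod_topology euclideanreal (mtopology_of F)) (mtopology_of F)
       (\<lambda>(a, x). a *\<^sub>R x)"
proof -
  show m: "mspace F = UNIV" and "mcomplete_of F" "mdist F (x + w) (y + w) = mdist F x y"
    "continuous_map (prod_topology euclideanreal (mtopology_of F)) (mtopology_of F)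
       (\<lambda>(a, x). a *\<^sub>R x)"
    using assms by (auto simp: frechet_def frechet_on_def)
  show "mdist F (a *\<^sub>R x + b *\<^sub>R y) 0 < r"
    if "mdist F x 0 < r" "mdist F y 0 < r" "\<bar>a\<bar> + \<bar>b\<bar> \<le> 1"
  proof -
    have "r > 0"
      using that(1) mdist_nonneg[of F x 0] by linarith
    then show ?thesis
      using assms that by (simp add: frechet_def frechet_on_def)
  qed
qed

lemma mdist_diff_frechet:
  assumes "frechet F" shows "mdist F x y = mdist F (x - y) 0"
  using mdist_translate[OF assms, of x "- y" y] by simp

lemma mdist_refl: "x \<in> mspace m \<Longrightarrow> mdist m x x = 0"
  by (simp only: mdist_zero)

lemma Hausdorff_mtopology_of: "Hausdorff_space (mtopology_of m)"
  by (metis Metric_space.Hausdorff_space_mtopology Metric_space_mspace_mdist mtopology_of_def)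

lemma openin_mtopology_of_ball:
  "openin (mtopology_of m) U \<longleftrightarrow>
     U \<subseteq> mspace m \<and> (\<forall>x\<in>U. \<exists>r>0. \<forall>y\<in>mspace m. mdist m x y < r \<longrightarrow> y \<in> U)"
  unfolding mtopology_of_def Metric_space.openin_mtopology[OF Metric_space_mspace_mdist]
    Metric_space.mball_def[OF Metric_space_mspace_mdist] by blast

lemma openin_mball_of: "openin (mtopology_of m) (mball_of m x r)"
  by (simp add: Metric_space.openin_mball mball_of_def mtopology_of_def)

text \<open>
  Balls are absolutely convex around \<open>0\<close> only; translation invariance makes every ball convex.
\<close>

lemma convex_mball_of_frechet:
  assumes F: "frechet F" shows "convex (mball_of F x r)"
proof (rule convexI)
  fix y z and a b :: real
  assume y: "y \<in> mball_of F x r" and z: "z \<in> mball_of F x r" and ab: "0 \<le> a" "0 \<le> b" "a + b = 1"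
  have "a *\<^sub>R (y - x) + b *\<^sub>R (z - x) = a *\<^sub>R y + b *\<^sub>R z - (a + b) *\<^sub>R x"
    by (simp add: algebra_simps)
  then have eq: "a *\<^sub>R (y - x) + b *\<^sub>R (z - x) = a *\<^sub>R y + b *\<^sub>R z - x"
    using ab by simp
  have "mdist F (y - x) 0 < r" "mdist F (z - x) 0 < r"
    using y z mdist_diff_frechet[OF F] by (auto simp: mdist_commute)
  then have "mdist F (a *\<^sub>R y + b *\<^sub>R z - x) 0 < r"
    using mdist_absconvex[OF F, of "y - x" r "z - x" a b] ab eq by simp
  then show "a *\<^sub>R y + b *\<^sub>R z \<in> mball_of F x r"
    using mdist_diff_frechet[OF F] by (simp add: mspace_frechet[OF F] mdist_commute[of F x])
qed

lemma convex_neighbourhood_frechet: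
  assumes F: "frechet F" and W: "openin (mtopology_of F) W" "x \<in> W"
  obtains C where "openin (mtopology_of F) C" "convex C" "x \<in> C" "C \<subseteq> W"
proof -
  obtain r where r: "r > 0" "\<forall>y\<in>mspace F. mdist F x y < r \<longrightarrow> y \<in> W"
    using W by (auto simp: openin_mtopology_of_ball)
  show thesis
  proof (rule that[OF openin_mball_of convex_mball_of_frechet[OF F]])
    show "x \<in> mball_of F x r" "mball_of F x r \<subseteq> W"
      using r by (auto simp: mspace_frechet[OF F] mdist_refl)
  qed
qed

text \<open>
  A mean value theorem by Bolzano induction on intervals: that the increment of \<open>\<gamma>\<close> over an interval
  lies in \<open>C\<close> scaled by the length holds for short intervals around each point because \<open>C\<close> is open,
  and it passes to unions of adjacent intervals because \<open>C\<close> is convex.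
\<close>

lemma increment_in_convex:
  fixes \<gamma> :: "real \<Rightarrow> 'v::real_vector"
  assumes "a \<le> b" and C: "openin X C" "convex C"
    and deriv: "\<And>s. \<lbrakk>a \<le> s; s \<le> b\<rbrakk> \<Longrightarrow>
      \<exists>y\<in>C. limitin X (\<lambda>r. (\<gamma> (s + r) - \<gamma> s) /\<^sub>R r) y (at 0)"
  shows "\<exists>w\<in>C. \<gamma> b - \<gamma> a = (b - a) *\<^sub>R w"
  using \<open>a \<le> b\<close>
proof (rule Bolzano)
  have combine: "\<exists>w\<in>C. \<gamma> q - \<gamma> p = (q - p) *\<^sub>R w"
    if pc: "\<exists>w\<in>C. \<gamma> c - \<gamma> p = (c - p) *\<^sub>R w" and cq: "\<exists>w\<in>C. \<gamma> q - \<gamma> c = (q - c) *\<^sub>R w"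
      and "p \<le> c" "c \<le> q" for p c q
  proof -
    obtain w1 w2 where w: "w1 \<in> C" "\<gamma> c - \<gamma> p = (c - p) *\<^sub>R w1" "w2 \<in> C" "\<gamma> q - \<gamma> c = (q - c) *\<^sub>R w2"
      using pc cq by blast
    show ?thesis
    proof (cases "p = q")
      case True
      then show ?thesis using w(1) by auto
    next
      case False
      then have lt: "q - p > 0" using that(3,4) by simp
      define w where "w = ((c - p) / (q - p)) *\<^sub>R w1 + ((q - c) / (q - p)) *\<^sub>R w2"
      have "w \<in> C"
        unfolding w_def
      proof (rule convexD[OF C(2) w(1) w(3)])
        show "(c - p) / (q - p) + (q - c) / (q - p) = 1"
          using lt unfolding add_divide_distrib[symmetric] by simp
      qed (use lt that(3,4) in auto)
      moreover have "(q - p) *\<^sub>R w = (c - p) *\<^sub>R w1 + (q - c) *\<^sub>R w2"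
        unfolding w_def using lt by (simp add: scaleR_add_right)
      then have "(q - p) *\<^sub>R w = \<gamma> q - \<gamma> p"
        using w by (metis add.commute diff_add_cancel diff_add_eq)
      ultimately show ?thesis by metis
    qed
  qed
  then show "\<exists>w\<in>C. \<gamma> q - \<gamma> p = (q - p) *\<^sub>R w"
    if "\<exists>w\<in>C. \<gamma> c - \<gamma> p = (c - p) *\<^sub>R w" "\<exists>w\<in>C. \<gamma> q - \<gamma> c = (q - c) *\<^sub>R w" "p \<le> c" "c \<le> q"
    for p c q
    using that by blast
  fix s assume s: "a \<le> s" "s \<le> b"
  obtain y where y: "y \<in> C" and lim: "limitin X (\<lambda>r. (\<gamma> (s + r) - \<gamma> s) /\<^sub>R r) y (at 0)"
    using deriv s by blast
  have "\<forall>\<^sub>F r in at 0. (\<gamma> (s + r) - \<gamma> s) /\<^sub>R r \<in> C"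
    using lim C(1) y by (auto simp: limitin_def)
  then obtain d where "d > 0"
    and d: "\<And>r. \<lbrakk>r \<noteq> 0; \<bar>r\<bar> < d\<rbrakk> \<Longrightarrow> (\<gamma> (s + r) - \<gamma> s) /\<^sub>R r \<in> C"
    by (auto simp: eventually_at)
  have near: "\<exists>w\<in>C. \<gamma> (s + r) - \<gamma> s = r *\<^sub>R w" if "\<bar>r\<bar> < d" for r
  proof (cases "r = 0")
    case True
    then show ?thesis using y by auto
  next
    case False
    then show ?thesis using d[OF False that] by (intro bexI[of _ "(\<gamma> (s + r) - \<gamma> s) /\<^sub>R r"]) auto
  qed
  show "\<exists>d>0. \<forall>p q. p \<le> s \<and> s \<le> q \<and> q - p < d \<longrightarrow> (\<exists>w\<in>C. \<gamma> q - \<gamma> p = (q - p) *\<^sub>R w)"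
  proof (intro exI[of _ d] conjI allI impI \<open>d > 0\<close>)
    fix p q assume pq: "p \<le> s \<and> s \<le> q \<and> q - p < d"
    obtain w where "w \<in> C" "\<gamma> p - \<gamma> s = (p - s) *\<^sub>R w"
      using near[of "p - s"] pq by auto
    then have "\<exists>w\<in>C. \<gamma> s - \<gamma> p = (s - p) *\<^sub>R w"
      by (metis minus_diff_eq scaleR_minus_left)
    moreover have "\<exists>w\<in>C. \<gamma> q - \<gamma> s = (q - s) *\<^sub>R w"
      using near[of "q - s"] pq by auto
    ultimately show "\<exists>w\<in>C. \<gamma> q - \<gamma> p = (q - p) *\<^sub>R w"
      using combine pq by blast
  qed
qed

lemma limitin_rescale:
  assumes "limitin X f y (at (0::real))" "t \<noteq> 0"
  shows "limitin X (\<lambda>r. f (r * t)) y (at 0)"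
proof -
  have "filterlim (\<lambda>r. r * t) (at 0) (at 0)"
    using assms(2) by (auto simp: filterlim_at eventually_at intro!: tendsto_eq_intros exI[of _ 1])
  then show ?thesis
    using assms(1) by (auto simp: limitin_def intro: eventually_compose_filterlim)
qed

text \<open>
  Along a curve the difference quotient of \<open>P\<close> is an increment of \<open>P\<close> over a segment whose direction is
  close to \<open>v\<close>, so by joint continuity of the derivative all derivatives along the segment lie in a
  prescribed convex neighbourhood of the expected limit.
\<close>

lemma chain_rule_curve:
  fixes P :: "'e::real_vector \<Rightarrow> 'v::real_vector"
  assumes E: "frechet E" and G: "frechet G" and U: "openin (mtopology_of E) U" "x \<in> U"
    and P: "keller_differentiable E G U P"
    and c: "limitin (mtopology_of E) c x (at (0::real))"
    and c': "limitin (mtopology_of E) (\<lambda>t. (c t - x) /\<^sub>R t) v (at 0)"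
  shows "limitin (mtopology_of G) (\<lambda>t. (P (c t) - P x) /\<^sub>R t) (dir_deriv G P x v) (at 0)"
  unfolding limitin_def
proof (intro conjI allI impI)
  show "dir_deriv G P x v \<in> topspace (mtopology_of G)"
    by (simp add: mspace_frechet[OF G])
  fix W assume W: "openin (mtopology_of G) W \<and> dir_deriv G P x v \<in> W"
  then obtain C where C: "openin (mtopology_of G) C" "convex C" "dir_deriv G P x v \<in> C" "C \<subseteq> W"
    using convex_neighbourhood_frechet[OF G] by blast
  \<comment> \<open>Joint continuity of the derivative yields a convex \<open>B\<close> around \<open>x\<close> and a neighbourhood \<open>N2\<close> of
    \<open>v\<close> on which its values stay in \<open>C\<close>.\<close>
  define O1 where
    "O1 = {z \<in> topspace (prod_topology (subtopology (mtopology_of E) U) (mtopology_of E)).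
             (\<lambda>(u, h). dir_deriv G P u h) z \<in> C}"
  have "openin (prod_topology (subtopology (mtopology_of E) U) (mtopology_of E)) O1"
    unfolding O1_def using P C(1) by (auto simp: keller_differentiable_def continuous_map)
  moreover have "(x, v) \<in> O1"
    using U C(3) by (auto simp: O1_def mspace_frechet[OF E])
  ultimately have "\<exists>N1 N2. openin (subtopology (mtopology_of E) U) N1 \<and> openin (mtopology_of E) N2 \<and>
      x \<in> N1 \<and> v \<in> N2 \<and> N1 \<times> N2 \<subseteq> O1"
    by (simp only: openin_prod_topology_alt)
  then obtain N1 N2 where N: "openin (subtopology (mtopology_of E) U) N1"
    "openin (mtopology_of E) N2" "x \<in> N1" "v \<in> N2" "N1 \<times> N2 \<subseteq> O1"
    by blast
  then have "openin (mtopology_of E) N1"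
    using U by (simp add: openin_open_subtopology)
  then obtain B where B: "openin (mtopology_of E) B" "convex B" "x \<in> B" "B \<subseteq> N1"
    using convex_neighbourhood_frechet[OF E] N(3) by blast
  have "\<forall>\<^sub>F t in at 0. c t \<in> B" "\<forall>\<^sub>F t in at 0. (c t - x) /\<^sub>R t \<in> N2"
    using c c' B N by (auto simp: limitin_def)
  moreover have "\<forall>\<^sub>F t in at (0::real). t \<noteq> 0"
    by (auto simp: eventually_at intro: exI[of _ 1])
  ultimately show "\<forall>\<^sub>F t in at 0. (P (c t) - P x) /\<^sub>R t \<in> W"
  proof eventually_elim
    fix t :: real assume t: "c t \<in> B" "(c t - x) /\<^sub>R t \<in> N2" "t \<noteq> 0"
    define h where "h = (c t - x) /\<^sub>R t"
    \<comment> \<open>The division by \<open>t\<close> makes the increment of \<open>\<gamma>\<close> over the unit interval the difference quotient,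
      also for negative \<open>t\<close>.\<close>
    define \<gamma> where "\<gamma> = (\<lambda>s. P (x + (s * t) *\<^sub>R h) /\<^sub>R t)"
    have "\<exists>w\<in>C. \<gamma> 1 - \<gamma> 0 = (1 - 0) *\<^sub>R w"
    proof (rule increment_in_convex[OF _ C(1,2)])
      fix s :: real assume s: "0 \<le> s" "s \<le> 1"
      define u where "u = x + (s * t) *\<^sub>R h"
      have "u = (1 - s) *\<^sub>R x + s *\<^sub>R c t"
        using t(3) by (simp add: u_def h_def algebra_simps)
      then have "u \<in> B"
        using s convexD[OF B(2) B(3) t(1), of "1 - s" s] by simp
      then have "(u, h) \<in> O1"
        using B(4) N(5) t(2) unfolding h_def by blast
      then have uh: "u \<in> U" "dir_deriv G P u h \<in> C"
        by (auto simp: O1_def)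
      have "limitin (mtopology_of G) (\<lambda>r. (P (u + r *\<^sub>R h) - P u) /\<^sub>R r) (dir_deriv G P u h) (at 0)"
        using P uh(1) by (auto simp: keller_differentiable_def differentiable_pt_def)
      from limitin_rescale[OF this t(3)]
      have "limitin (mtopology_of G) (\<lambda>r. (\<gamma> (s + r) - \<gamma> s) /\<^sub>R r) (dir_deriv G P u h) (at 0)"
        by (simp add: \<gamma>_def u_def algebra_simps)
      then show "\<exists>y\<in>C. limitin (mtopology_of G) (\<lambda>r. (\<gamma> (s + r) - \<gamma> s) /\<^sub>R r) y (at 0)"
        using uh(2) by blast
    qed simp
    moreover have "\<gamma> 1 - \<gamma> 0 = (P (c t) - P x) /\<^sub>R t"
      using t(3) by (simp add: \<gamma>_def h_def scaleR_diff_right)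
    ultimately show "(P (c t) - P x) /\<^sub>R t \<in> W"
      using C(4) by auto
  qed
qed

lemma MC_on_imp_b_differentiable:
  assumes "k \<ge> 1" "MC_on k E G U P"
  shows "b_differentiable E G U P"
proof -
  have "b_differentiable E G U P" if "MC_nat (Suc n) E G U P" for n
    using that by (cases n) (auto simp: MC_step_def)
  then show ?thesis
    using assms by (cases k) (auto simp: MC_on_def enat_1_iff one_enat_def Suc_le_eq dest!: gr0_implies_Suc split: enat.splits)
qed

lemma MC_on_0 [simp]: "MC_on 0 E G U P \<longleftrightarrow> cont_on E G U P"
  by (simp add: MC_on_def zero_enat_def)

section \<open>Topologies generated by charts\<close>

text \<open>
  An atlas with open overlaps and continuous coordinate changes turns a bare set into a space in which
  every chart is a homeomorphism onto an open set. The point is that no chart domain acquires unexpected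
  open sets from the other charts: by induction over the generation of the topology, every open set has
  open image in every chart.
\<close>

lemma topology_generated_by_charts:
  fixes \<C> :: "('a set \<times> ('a \<Rightarrow> 'b)) set"
  assumes inj: "\<And>A c. (A, c) \<in> \<C> \<Longrightarrow> inj_on c A"
    and range: "\<And>A c. (A, c) \<in> \<C> \<Longrightarrow> c ` A \<subseteq> topspace Y"
    and overlap: "\<And>A c B d W. \<lbrakk>(A, c) \<in> \<C>; (B, d) \<in> \<C>; openin Y W\<rbrakk>
      \<Longrightarrow> openin Y (c ` {x \<in> A \<inter> B. d x \<in> W})"
  defines "T \<equiv> topology_generated_by {{x \<in> A. c x \<in> W} | A c W. (A, c) \<in> \<C> \<and> openin Y W}"
  shows topspace_chart_topology: "topspace T = (\<Union>(A, c)\<in>\<C>. A)"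
    and openin_chart_domain: "(A, c) \<in> \<C> \<Longrightarrow> openin T A"
    and openin_chart_image: "(A, c) \<in> \<C> \<Longrightarrow> openin Y (c ` A)"
    and homeomorphic_chart: "(A, c) \<in> \<C> \<Longrightarrow> homeomorphic_map (subtopology T A) (subtopology Y (c ` A)) c"
proof -
  have basic: "openin T {x \<in> A. c x \<in> W}" if "(A, c) \<in> \<C>" "openin Y W" for A c W
    unfolding T_def by (rule topology_generated_by_Basis) (use that in blast)
  have whole: "{x \<in> A. c x \<in> topspace Y} = A" if "(A, c) \<in> \<C>" for A c
    using range[OF that] by auto
  show dom: "openin T A" if "(A, c) \<in> \<C>" for A c
    using basic[OF that openin_topspace] whole[OF that] by simp
  show image: "openin Y (c ` A)" if "(A, c) \<in> \<C>" for A c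
    using overlap[OF that that openin_topspace] whole[OF that] by simp
  show topspace: "topspace T = (\<Union>(A, c)\<in>\<C>. A)"
  proof
    show "topspace T \<subseteq> (\<Union>(A, c)\<in>\<C>. A)"
      unfolding T_def topology_generated_by_topspace by blast
    show "(\<Union>(A, c)\<in>\<C>. A) \<subseteq> topspace T"
      using dom openin_subset by blast
  qed
  have chart_open: "openin Y (c ` (A \<inter> S))" if Ac: "(A, c) \<in> \<C>" and "openin T S" for A c S
  proof -
    have "generate_topology_on {{x \<in> A. c x \<in> W} | A c W. (A, c) \<in> \<C> \<and> openin Y W} S"
      using that(2) unfolding T_def openin_topology_generated_by_iff .
    then show ?thesis
    proof induction
      case Empty
      then show ?case by simp
    next
      case (Int a b)
      have "c ` (A \<inter> (a \<inter> b)) = c ` (A \<inter> a) \<inter> c ` (A \<inter> b)"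
        using inj_on_image_Int[OF inj[OF Ac], of "A \<inter> a" "A \<inter> b"] by (simp add: Int_ac)
      then show ?case using openin_Int[OF Int.IH] by simp
    next
      case (UN K)
      have "c ` (A \<inter> \<Union>K) = (\<Union>k\<in>K. c ` (A \<inter> k))" by blast
      then show ?case using UN.IH by auto
    next
      case (Basis s)
      then obtain B d W where "s = {x \<in> B. d x \<in> W}" "(B, d) \<in> \<C>" "openin Y W" by blast
      moreover from this have "A \<inter> s = {x \<in> A \<inter> B. d x \<in> W}" by blast
      ultimately show ?case using overlap[OF Ac] by simp
    qed
  qed
  show "homeomorphic_map (subtopology T A) (subtopology Y (c ` A)) c" if Ac: "(A, c) \<in> \<C>"
  proof (rule bijective_open_imp_homeomorphic_map)
    have ts: "topspace (subtopology T A) = A"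
      using dom[OF Ac] openin_subset by (auto simp: inf_absorb2)
    show "c ` topspace (subtopology T A) = topspace (subtopology Y (c ` A))"
      using ts range[OF Ac] by (auto simp: inf_absorb2)
    show "inj_on c (topspace (subtopology T A))"
      using ts inj[OF Ac] by simp
    have "continuous_map (subtopology T A) Y c"
      unfolding continuous_map ts
    proof (intro conjI allI impI)
      show "c ` A \<subseteq> topspace Y" by (rule range[OF Ac])
      fix W assume "openin Y W"
      from basic[OF Ac this] show "openin (subtopology T A) {x \<in> A. c x \<in> W}"
        by (simp add: openin_open_subtopology[OF dom[OF Ac]])
    qed
    then show "continuous_map (subtopology T A) (subtopology Y (c ` A)) c"
      using ts by (simp add: continuous_map_in_subtopology)
    show "open_map (subtopology T A) (subtopology Y (c ` A)) c"
      unfolding open_map_def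
    proof (intro allI impI)
      fix S assume "openin (subtopology T A) S"
      then have "openin T S" "S \<subseteq> A"
        by (simp_all add: openin_open_subtopology[OF dom[OF Ac]])
      then have "openin Y (c ` S)"
        using chart_open[OF Ac] by (metis inf.absorb_iff2)
      then show "openin (subtopology Y (c ` A)) (c ` S)"
        using \<open>S \<subseteq> A\<close> by (simp add: openin_open_subtopology[OF image[OF Ac]] image_mono)
    qed
  qed
qed

lemma homeomorphic_maps_inv_into:
  assumes "homeomorphic_map X Y f"
  shows "homeomorphic_maps X Y f (inv_into (topspace X) f)"
proof -
  obtain g where g: "homeomorphic_maps X Y f g"
    using assms homeomorphic_map_maps by blast
  show ?thesis
  proof (rule homeomorphic_maps_eq[OF g])
    fix y assume "y \<in> topspace Y"
    then have "g y \<in> topspace X" "f (g y) = y"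
      using g by (auto simp: homeomorphic_maps_def continuous_map_def)
    then show "g y = inv_into (topspace X) f y"
      using inv_into_f_f[OF homeomorphic_imp_injective_map[OF assms]] by metis
  qed simp
qed

section \<open>Second countability\<close>

lemma second_countable_Union_open:
  assumes I: "countable I" and A: "\<And>i. i \<in> I \<Longrightarrow> openin X (A i)"
    and cover: "topspace X \<subseteq> (\<Union>i\<in>I. A i)"
    and sc: "\<And>i. i \<in> I \<Longrightarrow> second_countable (subtopology X (A i))"
  shows "second_countable X"
proof -
  have "\<forall>i\<in>I. \<exists>\<B>. countable \<B> \<and> (\<forall>V\<in>\<B>. openin X V \<and> V \<subseteq> A i) \<and>
      (\<forall>U x. (openin X U \<and> U \<subseteq> A i) \<and> x \<in> U \<longrightarrow> (\<exists>V\<in>\<B>. x \<in> V \<and> V \<subseteq> U))"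
  proof
    fix i assume i: "i \<in> I"
    from sc[OF i] show "\<exists>\<B>. countable \<B> \<and> (\<forall>V\<in>\<B>. openin X V \<and> V \<subseteq> A i) \<and>
      (\<forall>U x. (openin X U \<and> U \<subseteq> A i) \<and> x \<in> U \<longrightarrow> (\<exists>V\<in>\<B>. x \<in> V \<and> V \<subseteq> U))"
      by (simp only: second_countable_def openin_open_subtopology[OF A[OF i]])
  qed
  from bchoice[OF this] obtain \<B> where
    \<B>: "\<forall>i\<in>I. countable (\<B> i) \<and> (\<forall>V\<in>\<B> i. openin X V \<and> V \<subseteq> A i) \<and>
      (\<forall>U x. (openin X U \<and> U \<subseteq> A i) \<and> x \<in> U \<longrightarrow> (\<exists>V\<in>\<B> i. x \<in> V \<and> V \<subseteq> U))"
    by (elim exE)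
  have B: "countable (\<B> i)" "\<And>V. V \<in> \<B> i \<Longrightarrow> openin X V"
    "\<And>U x. \<lbrakk>openin X U; x \<in> U; U \<subseteq> A i\<rbrakk> \<Longrightarrow> \<exists>V\<in>\<B> i. x \<in> V \<and> V \<subseteq> U" if "i \<in> I" for i
    using bspec[OF \<B> that] by blast+
  show ?thesis
    unfolding second_countable_def
  proof (intro exI[of _ "\<Union>i\<in>I. \<B> i"] conjI ballI allI impI)
    show "countable (\<Union>i\<in>I. \<B> i)" using I B(1) by blast
    show "openin X V" if "V \<in> (\<Union>i\<in>I. \<B> i)" for V using that B(2) by auto
    fix U x assume U: "openin X U \<and> x \<in> U"
    then have "x \<in> topspace X" using openin_subset by blast
    then obtain i where i: "i \<in> I" "x \<in> A i"
      using cover by blast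
    have "openin X (U \<inter> A i)" using U A[OF i(1)] by blast
    then obtain V where "V \<in> \<B> i" "x \<in> V" "V \<subseteq> U \<inter> A i"
      using B(3)[OF i(1), of "U \<inter> A i" x] U i(2) by auto
    then show "\<exists>V\<in>\<Union>i\<in>I. \<B> i. x \<in> V \<and> V \<subseteq> U" using i by blast
  qed
qed

lemma second_countable_prod_topology:
  assumes "second_countable X" "second_countable Y"
  shows "second_countable (prod_topology X Y)"
proof -
  obtain \<A> where A: "countable \<A>" "\<forall>V\<in>\<A>. openin X V"
    "\<forall>U x. openin X U \<and> x \<in> U \<longrightarrow> (\<exists>V\<in>\<A>. x \<in> V \<and> V \<subseteq> U)"
    using assms(1) unfolding second_countable_def by (elim exE conjE)
  obtain \<B> where B: "countable \<B>" "\<forall>V\<in>\<B>. openin Y V"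
    "\<forall>U x. openin Y U \<and> x \<in> U \<longrightarrow> (\<exists>V\<in>\<B>. x \<in> V \<and> V \<subseteq> U)"
    using assms(2) unfolding second_countable_def by (elim exE conjE)
  show ?thesis
    unfolding second_countable_def
  proof (intro exI[of _ "(\<lambda>(V, W). V \<times> W) ` (\<A> \<times> \<B>)"] conjI ballI allI impI)
    show "countable ((\<lambda>(V, W). V \<times> W) ` (\<A> \<times> \<B>))" using A(1) B(1) by simp
    show "openin (prod_topology X Y) V" if "V \<in> (\<lambda>(V, W). V \<times> W) ` (\<A> \<times> \<B>)" for V
      using that A(2) B(2) by (auto simp: openin_prod_Times_iff)
    fix U z assume U: "openin (prod_topology X Y) U \<and> z \<in> U"
    obtain x y where z: "z = (x, y)" by force
    have "\<exists>V W. openin X V \<and> openin Y W \<and> x \<in> V \<and> y \<in> W \<and> V \<times> W \<subseteq> U"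
      using U unfolding z by (simp only: openin_prod_topology_alt)
    then obtain V W where VW: "openin X V" "openin Y W" "x \<in> V" "y \<in> W" "V \<times> W \<subseteq> U"
      by blast
    obtain V' W' where "V' \<in> \<A>" "x \<in> V'" "V' \<subseteq> V" "W' \<in> \<B>" "y \<in> W'" "W' \<subseteq> W"
      using A(3)[rule_format, of V x] B(3)[rule_format, of W y] VW by metis
    then show "\<exists>V\<in>(\<lambda>(V, W). V \<times> W) ` (\<A> \<times> \<B>). z \<in> V \<and> V \<subseteq> U"
      using VW(5) z by (intro bexI[of _ "V' \<times> W'"]) auto
  qed
qed

lemma homeomorphic_map_affine_frechet:
  assumes F: "frechet F" and a: "a \<noteq> 0"
  shows "homeomorphic_map (mtopology_of F) (mtopology_of F) (\<lambda>x. a *\<^sub>R (x - x0))"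
proof -
  have sub: "continuous_map (mtopology_of F) (mtopology_of F) (\<lambda>x. x - w)" for w
    unfolding continuous_map
  proof (intro conjI allI impI)
    show "(\<lambda>x. x - w) ` topspace (mtopology_of F) \<subseteq> topspace (mtopology_of F)"
      by (simp add: mspace_frechet[OF F])
    fix U assume U: "openin (mtopology_of F) U"
    have "mdist F (x - w) (y - w) = mdist F x y" for x y
      using mdist_translate[OF F, of x "-w" y] by simp
    then show "openin (mtopology_of F) {x \<in> topspace (mtopology_of F). x - w \<in> U}"
      using U unfolding openin_mtopology_of_ball by (simp add: mspace_frechet[OF F]) metis
  qed
  have scale: "continuous_map (mtopology_of F) (mtopology_of F) (\<lambda>x. b *\<^sub>R x)" for b
  proof -
    have "continuous_map (mtopology_of F) (prod_topology euclideanreal (mtopology_of F)) (\<lambda>x. (b, x))"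
      by (auto intro!: continuous_map_pairedI)
    from continuous_map_compose[OF this continuous_scaleR[OF F]] show ?thesis
      by (simp add: o_def)
  qed
  have "homeomorphic_maps (mtopology_of F) (mtopology_of F) (\<lambda>x. a *\<^sub>R (x - x0))
          (\<lambda>y. inverse a *\<^sub>R y - (- x0))"
    unfolding homeomorphic_maps_def
    using continuous_map_compose[OF sub[of x0] scale[of a]]
      continuous_map_compose[OF scale[of "inverse a"] sub[of "- x0"]] a
    by (simp add: o_def)
  then show ?thesis
    using homeomorphic_maps_imp_map by blast
qed

text \<open>
  A neighbourhood of a point, translated to the origin, absorbs the whole space, so countably many
  dilated copies of it cover the space.
\<close>

lemma second_countable_frechet:
  assumes F: "frechet F" and N: "openin (mtopology_of F) N" "N \<noteq> {}"
    and sc: "second_countable (subtopology (mtopology_of F) N)"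
  shows "second_countable (mtopology_of F)"
proof -
  obtain x0 where x0: "x0 \<in> N" using N by blast
  define A where "A n = (\<lambda>x. real (Suc n) *\<^sub>R (x - x0)) ` N" for n
  have hom: "homeomorphic_map (mtopology_of F) (mtopology_of F) (\<lambda>x. real (Suc n) *\<^sub>R (x - x0))" for n
    by (rule homeomorphic_map_affine_frechet[OF F]) simp
  show ?thesis
  proof (rule second_countable_Union_open[where I = UNIV and A = A])
    show "openin (mtopology_of F) (A n)" for n
      unfolding A_def using homeomorphic_map_openness[OF hom] N(1) by (simp add: mspace_frechet[OF F])
    have "homeomorphic_map (subtopology (mtopology_of F) N) (subtopology (mtopology_of F) (A n))
            (\<lambda>x. real (Suc n) *\<^sub>R (x - x0))" for n
      by (rule homeomorphic_map_subtopologies[OF hom]) (simp add: A_def mspace_frechet[OF F])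
    from homeomorphic_space_second_countability[OF homeomorphic_map_imp_homeomorphic_space[OF this]]
    show "second_countable (subtopology (mtopology_of F) (A n))" for n
      using sc by simp
    show "topspace (mtopology_of F) \<subseteq> (\<Union>n\<in>UNIV. A n)"
    proof
      fix y
      have "continuous_map euclideanreal (prod_topology euclideanreal (mtopology_of F)) (\<lambda>s. (s, y))"
        by (auto intro!: continuous_map_pairedI simp: mspace_frechet[OF F])
      from continuous_map_compose[OF this continuous_scaleR[OF F]]
      have "continuous_map euclideanreal (mtopology_of F) (\<lambda>s. s *\<^sub>R y)"
        by (simp add: o_def)
      moreover have "openin (mtopology_of F) ((\<lambda>x. 1 *\<^sub>R (x - x0)) ` N)"
        using homeomorphic_map_openness[OF homeomorphic_map_affine_frechet[OF F, of 1 x0]] N(1)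
        by (simp add: mspace_frechet[OF F])
      ultimately have "open {s. s *\<^sub>R y \<in> (\<lambda>x. x - x0) ` N}"
        by (simp add: continuous_map)
      moreover have "0 \<in> {s. s *\<^sub>R y \<in> (\<lambda>x. x - x0) ` N}"
        using x0 by force
      ultimately obtain e where "e > 0" "ball 0 e \<subseteq> {s. s *\<^sub>R y \<in> (\<lambda>x. x - x0) ` N}"
        by (rule openE)
      then have e: "e > 0" "\<And>s. \<bar>s\<bar> < e \<Longrightarrow> s *\<^sub>R y \<in> (\<lambda>x. x - x0) ` N"
        by (auto simp: subset_iff)
      obtain n where "inverse (real (Suc n)) < e"
        using reals_Archimedean[OF e(1)] by (elim exE)
      then have "inverse (real (Suc n)) *\<^sub>R y \<in> (\<lambda>x. x - x0) ` N"
        by (intro e(2)) simp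
      then obtain x where x: "x \<in> N" "inverse (real (Suc n)) *\<^sub>R y = x - x0"
        by (elim imageE)
      have "y = real (Suc n) *\<^sub>R (inverse (real (Suc n)) *\<^sub>R y)"
        by simp
      then have "y = real (Suc n) *\<^sub>R (x - x0)"
        unfolding x(2) .
      then show "y \<in> (\<Union>n\<in>UNIV. A n)"
        using x(1) unfolding A_def by blast
    qed
  qed simp
qed

section \<open>The maximum metric\<close>

lemma max_metric_Metric_space:
  "Metric_space (mspace A \<times> mspace B) (\<lambda>(x, y) (x', y'). max (mdist A x x') (mdist B y y'))"
proof
  fix z z' z'' :: "'a \<times> 'b"
  obtain x y x' y' x'' y'' where eq: "z = (x, y)" "z' = (x', y')" "z'' = (x'', y'')"
    by (cases z, cases z', cases z'')
  show "0 \<le> (\<lambda>(x, y) (x', y'). max (mdist A x x') (mdist B y y')) z z'"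
    by (simp add: eq le_max_iff_disj)
  show "(\<lambda>(x, y) (x', y'). max (mdist A x x') (mdist B y y')) z z' =
        (\<lambda>(x, y) (x', y'). max (mdist A x x') (mdist B y y')) z' z"
    by (simp add: eq mdist_commute)
  assume z: "z \<in> mspace A \<times> mspace B" "z' \<in> mspace A \<times> mspace B"
  have zero: "max a b = 0 \<longleftrightarrow> a = 0 \<and> b = 0" if "0 \<le> a" "0 \<le> b" for a b :: real
    using that by (auto simp: max_def)
  have "mdist A x x' = 0 \<longleftrightarrow> x = x'" "mdist B y y' = 0 \<longleftrightarrow> y = y'"
    using z by (simp_all add: eq)
  then show "((\<lambda>(x, y) (x', y'). max (mdist A x x') (mdist B y y')) z z' = 0) = (z = z')"
    using zero[of "mdist A x x'" "mdist B y y'"] by (simp add: eq)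
  assume "z'' \<in> mspace A \<times> mspace B"
  with z have "mdist A x x'' \<le> mdist A x x' + mdist A x' x''" "mdist B y y'' \<le> mdist B y y' + mdist B y' y''"
    by (auto simp: eq intro: mdist_triangle)
  then show "(\<lambda>(x, y) (x', y'). max (mdist A x x') (mdist B y y')) z z'' \<le>
      (\<lambda>(x, y) (x', y'). max (mdist A x x') (mdist B y y')) z z' +
      (\<lambda>(x, y) (x', y'). max (mdist A x x') (mdist B y y')) z' z''"
    unfolding eq prod.case by linarith
qed

lemma mspace_max_metric [simp]: "mspace (max_metric A B) = mspace A \<times> mspace B"
  by (simp add: max_metric_def Metric_space.mspace_metric[OF max_metric_Metric_space])

lemma mdist_max_metric [simp]:
  "mdist (max_metric A B) (x, y) (x', y') = max (mdist A x x') (mdist B y y')"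
  by (simp add: max_metric_def Metric_space.mdist_metric[OF max_metric_Metric_space])

lemma mtopology_of_max_metric:
  "mtopology_of (max_metric A B) = prod_topology (mtopology_of A) (mtopology_of B)"
proof (rule topology_eq[THEN iffD2], intro allI iffI)
  fix S
  assume S: "openin (mtopology_of (max_metric A B)) S"
  show "openin (prod_topology (mtopology_of A) (mtopology_of B)) S"
    unfolding openin_prod_topology_alt
  proof (intro allI impI)
    fix x y assume xy: "(x, y) \<in> S"
    have "\<forall>w\<in>S. \<exists>r>0. \<forall>z\<in>mspace A \<times> mspace B. mdist (max_metric A B) w z < r \<longrightarrow> z \<in> S"
      using S unfolding openin_mtopology_of_ball mspace_max_metric by (rule conjunct2)
    from bspec[OF this xy] obtain r
      where r: "r > 0" "\<forall>z\<in>mspace A \<times> mspace B. mdist (max_metric A B) (x, y) z < r \<longrightarrow> z \<in> S"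
      by (elim exE conjE)
    have xy': "x \<in> mspace A" "y \<in> mspace B"
      using S xy by (auto simp: openin_mtopology_of_ball)
    then show "\<exists>U V. openin (mtopology_of A) U \<and> openin (mtopology_of B) V \<and> x \<in> U \<and> y \<in> V \<and> U \<times> V \<subseteq> S"
      using r by (intro exI[of _ "mball_of A x r"] exI[of _ "mball_of B y r"]) (auto simp: openin_mball_of mdist_refl)
  qed
next
  fix S
  assume S: "openin (prod_topology (mtopology_of A) (mtopology_of B)) S"
  show "openin (mtopology_of (max_metric A B)) S"
    unfolding openin_mtopology_of_ball
  proof (intro conjI ballI)
    show "S \<subseteq> mspace (max_metric A B)"
      using openin_subset[OF S] by simp
    fix z assume "z \<in> S"
    obtain x y where xy: "z = (x, y)" by force
    have "\<exists>U V. openin (mtopology_of A) U \<and> openin (mtopology_of B) V \<and> x \<in> U \<and> y \<in> V \<and> U \<times> V \<subseteq> S"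
      using S \<open>z \<in> S\<close> unfolding xy by (simp only: openin_prod_topology_alt)
    then obtain U V where z: "z = (x, y)" "openin (mtopology_of A) U" "openin (mtopology_of B) V"
      "x \<in> U" "y \<in> V" "U \<times> V \<subseteq> S"
      using xy by blast
    have "\<exists>r>0. \<forall>x'\<in>mspace A. mdist A x x' < r \<longrightarrow> x' \<in> U" "\<exists>s>0. \<forall>y'\<in>mspace B. mdist B y y' < s \<longrightarrow> y' \<in> V"
      using z unfolding openin_mtopology_of_ball by simp_all
    then obtain r s where "r > 0" "\<forall>x'\<in>mspace A. mdist A x x' < r \<longrightarrow> x' \<in> U"
      "s > 0" "\<forall>y'\<in>mspace B. mdist B y y' < s \<longrightarrow> y' \<in> V"
      by (elim exE conjE)
    then show "\<exists>r>0. \<forall>w\<in>mspace (max_metric A B). mdist (max_metric A B) z w < r \<longrightarrow> w \<in> S"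
      using z by (intro exI[of _ "min r s"]) auto
  qed
qed

lemma mcomplete_of_max_metric:
  assumes "mcomplete_of A" "mcomplete_of B"
  shows "mcomplete_of (max_metric A B)"
proof -
  interpret M: Metric_space "mspace (max_metric A B)" "mdist (max_metric A B)" by (rule Metric_space_mspace_mdist)
  interpret A: Metric_space "mspace A" "mdist A" by simp
  interpret B: Metric_space "mspace B" "mdist B" by simp
  show ?thesis
    unfolding mcomplete_of_def M.mcomplete_def
  proof (intro allI impI)
    fix \<sigma> assume \<sigma>: "M.MCauchy \<sigma>"
    have dist: "mdist (max_metric A B) (\<sigma> n) (\<sigma> n') =
        max (mdist A (fst (\<sigma> n)) (fst (\<sigma> n'))) (mdist B (snd (\<sigma> n)) (snd (\<sigma> n')))" for n n'
      by (metis mdist_max_metric prod.collapse)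
    have "A.MCauchy (fst \<circ> \<sigma>)" "B.MCauchy (snd \<circ> \<sigma>)"
      using \<sigma> unfolding M.MCauchy_def A.MCauchy_def B.MCauchy_def dist
      by (force simp: image_subset_iff mem_Times_iff)+
    then obtain a b where "limitin A.mtopology (fst \<circ> \<sigma>) a sequentially"
      "limitin B.mtopology (snd \<circ> \<sigma>) b sequentially"
      using assms unfolding mcomplete_of_def A.mcomplete_def B.mcomplete_def by blast
    then have "limitin (mtopology_of (max_metric A B)) \<sigma> (a, b) sequentially"
      unfolding mtopology_of_max_metric by (simp add: limitin_pairwise mtopology_of_def)
    then show "\<exists>x. limitin M.mtopology \<sigma> x sequentially"
      unfolding mtopology_of_def by blast
  qed
qed

lemma vector_space_ops_UNIV: "vector_space_ops (UNIV :: 'v::real_vector set) (+) 0 (*\<^sub>R)"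
proof -
  have "\<exists>y. x + y = 0" for x :: 'v
    by (rule exI[of _ "- x"]) simp
  then show ?thesis
    by (simp add: vector_space_ops_def algebra_simps)
qed

lemma frechet_max_metric:
  assumes A: "frechet A" and B: "frechet B"
  shows "frechet (max_metric A B)"
  unfolding frechet_def frechet_on_def
proof (intro conjI)
  show "mspace (max_metric A B) = UNIV"
    by (simp add: mspace_frechet A B)
  then show "vector_space_ops (mspace (max_metric A B)) (+) 0 (*\<^sub>R)"
    using vector_space_ops_UNIV by simp
  show "mcomplete_of (max_metric A B)"
    by (rule mcomplete_of_max_metric[OF mcomplete_frechet[OF A] mcomplete_frechet[OF B]])
  show "\<forall>x\<in>mspace (max_metric A B). \<forall>y\<in>mspace (max_metric A B). \<forall>w\<in>mspace (max_metric A B).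
       mdist (max_metric A B) (x + w) (y + w) = mdist (max_metric A B) x y"
    by (auto simp: mdist_translate A B)
  show "\<forall>r>0. \<forall>x\<in>mspace (max_metric A B). \<forall>y\<in>mspace (max_metric A B). \<forall>a b.
       mdist (max_metric A B) x 0 < r \<and> mdist (max_metric A B) y 0 < r \<and> \<bar>a\<bar> + \<bar>b\<bar> \<le> 1 \<longrightarrow>
       mdist (max_metric A B) (a *\<^sub>R x + b *\<^sub>R y) 0 < r"
    using mdist_absconvex[OF A] mdist_absconvex[OF B] by (auto simp: zero_prod_def)
  have cf: "continuous_map (prod_topology euclideanreal (prod_topology (mtopology_of A) (mtopology_of B)))
      (prod_topology euclideanreal (mtopology_of A)) (\<lambda>z. (fst z, fst (snd z)))"
    by (intro continuous_map_pairedI continuous_map_fst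
        continuous_map_compose[OF continuous_map_snd continuous_map_fst, unfolded o_def])
  have cs: "continuous_map (prod_topology euclideanreal (prod_topology (mtopology_of A) (mtopology_of B)))
      (prod_topology euclideanreal (mtopology_of B)) (\<lambda>z. (fst z, snd (snd z)))"
    by (intro continuous_map_pairedI continuous_map_fst
        continuous_map_compose[OF continuous_map_snd continuous_map_snd, unfolded o_def])
  show "continuous_map (prod_topology euclideanreal (mtopology_of (max_metric A B)))
     (mtopology_of (max_metric A B)) (\<lambda>(a, x). a *\<^sub>R x)"
    unfolding mtopology_of_max_metric
    using continuous_map_compose[OF cf continuous_scaleR[OF A]]
      continuous_map_compose[OF cs continuous_scaleR[OF B]]
    by (simp add: continuous_map_pairwise o_def case_prod_unfold)
qed

section \<open>One-jets of curves in charts\<close>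

text \<open>
  The surjectivity of the charts of the tangent bundle belongs to the data, since not every vector of
  the model needs to be the velocity of a curve.
\<close>

locale tangent_atlas =
  fixes k :: enat and M :: "('m, 'f::real_vector) mfld"
  assumes order: "k \<ge> 1"
    and manifold: "MC_manifold k M"
    and full_charts: "has_tangent_charts k M"
begin

abbreviation model_top :: "'f topology" where
  "model_top \<equiv> mtopology_of (model M)"

abbreviation tangent_top :: "(real \<Rightarrow> 'm) set topology" where
  "tangent_top \<equiv> mtop (tangent_mfld k M)"

lemma frechet_model: "frechet (model M)"
  using manifold by (simp add: MC_manifold_def)

lemma mspace_model [simp]: "mspace (model M) = UNIV"
  by (rule mspace_frechet[OF frechet_model])

lemma topspace_charts: "(\<Union>(U, \<phi>)\<in>charts M. U) = topspace (mtop M)"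
  using manifold by (simp add: MC_manifold_def)

lemma chart_at:
  assumes "p \<in> topspace (mtop M)"
  obtains U \<phi> where "(U, \<phi>) \<in> charts M" "p \<in> U"
  using assms topspace_charts by blast

lemma chartD:
  assumes "(U, \<phi>) \<in> charts M"
  shows openin_chart: "openin (mtop M) U"
    and openin_image_chart: "openin model_top (\<phi> ` U)"
    and homeomorphic_map_chart: "homeomorphic_map (subtopology (mtop M) U) (subtopology model_top (\<phi> ` U)) \<phi>"
  using manifold assms by (auto simp: MC_manifold_def)

lemma topspace_subtopology_chart:
  assumes "(U, \<phi>) \<in> charts M" shows "topspace (subtopology (mtop M) U) = U"
  using openin_subset[OF openin_chart[OF assms]] by auto

lemma inj_on_chart:
  assumes "(U, \<phi>) \<in> charts M" shows "inj_on \<phi> U"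
  using homeomorphic_imp_injective_map[OF homeomorphic_map_chart[OF assms]]
  by (simp only: topspace_subtopology_chart[OF assms])

lemma openin_chart_overlap:
  assumes "(U, \<phi>) \<in> charts M" "openin (mtop M) V"
  shows "openin model_top (\<phi> ` (U \<inter> V))"
proof -
  have "openin (subtopology (mtop M) U) (U \<inter> V)"
    using assms by (simp add: openin_open_subtopology[OF openin_chart[OF assms(1)]] openin_chart openin_Int)
  then have "openin (subtopology model_top (\<phi> ` U)) (\<phi> ` (U \<inter> V))"
    using homeomorphic_map_openness[OF homeomorphic_map_chart[OF assms(1)], of "U \<inter> V"]
    by (simp only: topspace_subtopology_chart[OF assms(1)]) simp
  then show ?thesis
    by (simp add: openin_open_subtopology[OF openin_image_chart[OF assms(1)]])
qed

lemma transition_keller_differentiable: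
  assumes "(U, \<phi>) \<in> charts M" "(V, \<psi>) \<in> charts M"
  shows "keller_differentiable (model M) (model M) (\<phi> ` (U \<inter> V)) (\<psi> \<circ> inv_into U \<phi>)"
proof -
  have "MC_on k (model M) (model M) (\<phi> ` (U \<inter> V)) (\<psi> \<circ> inv_into U \<phi>)"
    using manifold assms by (auto simp: MC_manifold_def)
  from MC_on_imp_b_differentiable[OF order this] show ?thesis
    by (simp add: b_differentiable_def)
qed

lemma curve_in_chart:
  assumes f: "f \<in> curves_at k M p" and U: "(U, \<phi>) \<in> charts M" "p \<in> U"
  shows curve_eventually_in_chart: "\<forall>\<^sub>F t in at 0. f t \<in> U"
    and curve_continuous_at_0: "limitin model_top (\<lambda>t. \<phi> (f t)) (\<phi> p) (at 0)"
    and curve_velocity: "limitin model_top (\<lambda>t. (\<phi> (f t) - \<phi> p) /\<^sub>R t) (velocity M \<phi> f) (at 0)"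
proof -
  have f0: "f 0 = p" and map: "MC_map k (vec_mfld euclidean_metric) M f"
    using f by (auto simp: curves_at_def)
  have cont: "continuous_map euclideanreal (mtop M) f"
    using map by (simp add: MC_map_def vec_mfld_def)
  have "MC_on k euclidean_metric (model M) (f -` U) (\<phi> \<circ> f \<circ> inv_into UNIV (\<lambda>x. x))"
    using map U(1) by (auto simp: MC_map_def vec_mfld_def)
  moreover have "inv_into UNIV (\<lambda>x. x) = (\<lambda>x :: real. x)"
    by (rule ext, rule inv_into_f_f) auto
  ultimately have "MC_on k euclidean_metric (model M) (f -` U) (\<phi> \<circ> f)"
    by (simp add: o_def)
  from MC_on_imp_b_differentiable[OF order this]
  have kd: "keller_differentiable euclidean_metric (model M) (f -` U) (\<phi> \<circ> f)"
    by (simp add: b_differentiable_def)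
  have near: "\<forall>\<^sub>F t in at 0. t \<in> S" if "open S" "0 \<in> S" for S :: "real set"
    using that by (simp add: eventually_at_in_open' eventually_nhds_conv_at)
  have opU: "open (f -` U)"
  proof -
    have "openin euclideanreal {x \<in> topspace euclideanreal. f x \<in> U}"
      using cont openin_chart[OF U(1)] by (simp only: continuous_map)
    then show ?thesis by (simp add: vimage_def)
  qed
  from near[OF opU] show "\<forall>\<^sub>F t in at 0. f t \<in> U"
    using U(2) f0 by simp
  show "limitin model_top (\<lambda>t. \<phi> (f t)) (\<phi> p) (at 0)"
    unfolding limitin_def
  proof (intro conjI allI impI)
    fix W assume W: "openin model_top W \<and> \<phi> p \<in> W"
    have "continuous_map (subtopology euclideanreal (f -` U)) model_top (\<phi> \<circ> f)"
      using kd by (simp add: keller_differentiable_def cont_on_def)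
    then have "openin (subtopology euclideanreal (f -` U))
        {x \<in> topspace (subtopology euclideanreal (f -` U)). (\<phi> \<circ> f) x \<in> W}"
      using W by (simp only: continuous_map)
    then have "open {x \<in> f -` U. \<phi> (f x) \<in> W}"
      using opU by (simp add: openin_open_subtopology)
    then have "\<forall>\<^sub>F t in at 0. t \<in> {x \<in> f -` U. \<phi> (f x) \<in> W}"
      by (rule near) (use U(2) f0 W in simp)
    then show "\<forall>\<^sub>F t in at 0. \<phi> (f t) \<in> W"
      by (rule eventually_mono) simp
  qed simp
  have "0 \<in> f -` U"
    using U(2) f0 by simp
  then have "limitin model_top (\<lambda>t. ((\<phi> \<circ> f) (0 + t *\<^sub>R 1) - (\<phi> \<circ> f) 0) /\<^sub>R t)
      (dir_deriv (model M) (\<phi> \<circ> f) 0 1) (at 0)"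
    using kd by (simp only: keller_differentiable_def differentiable_pt_def)
  then show "limitin model_top (\<lambda>t. (\<phi> (f t) - \<phi> p) /\<^sub>R t) (velocity M \<phi> f) (at 0)"
    by (simp add: velocity_def f0)
qed

text \<open>
  The chain rule for curves makes the velocity transform by the derivative of the coordinate change.
  Hence equality of velocities, which defines one-jets, is independent of the chart.
\<close>

lemma velocity_change:
  assumes f: "f \<in> curves_at k M p"
    and U: "(U, \<phi>) \<in> charts M" "p \<in> U" and V: "(V, \<psi>) \<in> charts M" "p \<in> V"
  shows "velocity M \<psi> f = dir_deriv (model M) (\<psi> \<circ> inv_into U \<phi>) (\<phi> p) (velocity M \<phi> f)"
proof -
  have inv: "(\<psi> \<circ> inv_into U \<phi>) (\<phi> q) = \<psi> q" if "q \<in> U" for q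
    using inv_into_f_f[OF inj_on_chart[OF U(1)] that] by simp
  have "limitin model_top (\<lambda>t. ((\<psi> \<circ> inv_into U \<phi>) (\<phi> (f t)) - (\<psi> \<circ> inv_into U \<phi>) (\<phi> p)) /\<^sub>R t)
      (dir_deriv (model M) (\<psi> \<circ> inv_into U \<phi>) (\<phi> p) (velocity M \<phi> f)) (at 0)"
    using U(2) V(2)
    by (intro chain_rule_curve[OF frechet_model frechet_model
          openin_chart_overlap[OF U(1) openin_chart[OF V(1)]] _ transition_keller_differentiable[OF U(1) V(1)]
          curve_continuous_at_0[OF f U] curve_velocity[OF f U]]) auto
  then have "limitin model_top (\<lambda>t. (\<psi> (f t) - \<psi> p) /\<^sub>R t)
      (dir_deriv (model M) (\<psi> \<circ> inv_into U \<phi>) (\<phi> p) (velocity M \<phi> f)) (at 0)"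
  proof (rule limitin_transform_eventually[rotated])
    show "\<forall>\<^sub>F t in at 0. ((\<psi> \<circ> inv_into U \<phi>) (\<phi> (f t)) - (\<psi> \<circ> inv_into U \<phi>) (\<phi> p)) /\<^sub>R t =
        (\<psi> (f t) - \<psi> p) /\<^sub>R t"
      using curve_eventually_in_chart[OF f U]
      by (rule eventually_mono) (simp only: inv inv[OF U(2)])
  qed
  from limitin_Hausdorff_unique[OF curve_velocity[OF f V] this trivial_limit_at Hausdorff_mtopology_of]
  show ?thesis .
qed

lemma mem_jet_iff:
  assumes f: "f \<in> curves_at k M p" and U: "(U, \<phi>) \<in> charts M" "p \<in> U"
  shows "g \<in> jet k M p f \<longleftrightarrow> g \<in> curves_at k M p \<and> velocity M \<phi> f = velocity M \<phi> g"
proof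
  assume "g \<in> jet k M p f"
  then obtain V \<psi> where g: "g \<in> curves_at k M p" and V: "(V, \<psi>) \<in> charts M" "p \<in> V"
    "velocity M \<psi> f = velocity M \<psi> g"
    by (auto simp: jet_def)
  then show "g \<in> curves_at k M p \<and> velocity M \<phi> f = velocity M \<phi> g"
    by (simp only: velocity_change[OF f V(1,2) U] velocity_change[OF g V(1,2) U])
next
  assume "g \<in> curves_at k M p \<and> velocity M \<phi> f = velocity M \<phi> g"
  then show "g \<in> jet k M p f"
    using U by (auto simp: jet_def)
qed

lemma jet_eqI:
  assumes f: "f \<in> curves_at k M p" and g: "g \<in> curves_at k M p"
    and U: "(U, \<phi>) \<in> charts M" "p \<in> U" and eq: "velocity M \<phi> f = velocity M \<phi> g"
  shows "jet k M p f = jet k M p g"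
  by (rule set_eqI) (simp only: mem_jet_iff[OF f U] mem_jet_iff[OF g U] eq)

lemma tangent_proj_jet:
  assumes p: "p \<in> topspace (mtop M)" and f: "f \<in> curves_at k M p"
  shows "tangent_proj (jet k M p f) = p"
proof -
  obtain U \<phi> where U: "(U, \<phi>) \<in> charts M" "p \<in> U"
    using chart_at[OF p] .
  have "f \<in> jet k M p f"
    using f by (simp add: mem_jet_iff[OF f U])
  moreover have "g 0 = p" if "g \<in> jet k M p f" for g
    using that by (auto simp: jet_def curves_at_def)
  ultimately show ?thesis
    unfolding tangent_proj_def by (intro the_equality) auto
qed

lemma tangent_chart_jet:
  assumes f: "f \<in> curves_at k M p" and U: "(U, \<phi>) \<in> charts M" "p \<in> U"
  shows "tangent_chart M \<phi> (jet k M p f) = (\<phi> p, velocity M \<phi> f)"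
proof -
  have p: "p \<in> topspace (mtop M)"
    using openin_subset[OF openin_chart[OF U(1)]] U(2) by blast
  have "f \<in> jet k M p f"
    using f by (simp add: mem_jet_iff[OF f U])
  then have "(SOME g. g \<in> jet k M p f) \<in> jet k M p f"
    by (rule someI[of "\<lambda>g. g \<in> jet k M p f"])
  then show ?thesis
    using mem_jet_iff[OF f U] by (simp add: tangent_chart_def tangent_proj_jet[OF p f])
qed

lemma tangent_setE:
  assumes "j \<in> tangent_set k M"
  obtains p f where "p \<in> topspace (mtop M)" "f \<in> curves_at k M p" "j = jet k M p f" "tangent_proj j = p"
  using assms by (auto simp: tangent_set_def tangent_proj_jet)

lemma tangent_proj_in_topspace: "j \<in> tangent_set k M \<Longrightarrow> tangent_proj j \<in> topspace (mtop M)"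
  by (erule tangent_setE) simp

lemma tangent_over_Int: "tangent_over k M U \<inter> tangent_over k M V = tangent_over k M (U \<inter> V)"
  by (auto simp: tangent_over_def)

lemma fst_tangent_chart: "fst (tangent_chart M \<phi> j) = \<phi> (tangent_proj j)"
  by (simp add: tangent_chart_def)

lemma inj_on_tangent_chart:
  assumes U: "(U, \<phi>) \<in> charts M"
  shows "inj_on (tangent_chart M \<phi>) (tangent_over k M U)"
proof (rule inj_onI)
  fix i j
  assume "i \<in> tangent_over k M U" "j \<in> tangent_over k M U"
    and eq: "tangent_chart M \<phi> i = tangent_chart M \<phi> j"
  then have i: "i \<in> tangent_set k M" "tangent_proj i \<in> U" and j: "j \<in> tangent_set k M" "tangent_proj j \<in> U"
    by (auto simp: tangent_over_def)
  obtain p f where f: "f \<in> curves_at k M p" "i = jet k M p f" "tangent_proj i = p"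
    by (rule tangent_setE[OF i(1)])
  obtain q g where g: "g \<in> curves_at k M q" "j = jet k M q g" "tangent_proj j = q"
    by (rule tangent_setE[OF j(1)])
  have pU: "p \<in> U" and qU: "q \<in> U"
    using i(2) j(2) f(3) g(3) by simp_all
  have "(\<phi> p, velocity M \<phi> f) = (\<phi> q, velocity M \<phi> g)"
    using eq tangent_chart_jet[OF f(1) U pU] tangent_chart_jet[OF g(1) U qU] by (simp add: f(2) g(2))
  then have "p = q" "velocity M \<phi> f = velocity M \<phi> g"
    using inj_onD[OF inj_on_chart[OF U] _ pU qU] by auto
  then show "i = j"
    using jet_eqI[OF f(1) _ U pU] f(2) g(1,2) by simp
qed

text \<open>
  The surjectivity of \<open>T\<phi>\<close> passes to subsets of its domain, because the first component of \<open>T\<phi>\<close>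
  determines the base point.
\<close>

lemma tangent_chart_image:
  assumes U: "(U, \<phi>) \<in> charts M" and "V \<subseteq> U"
  shows "tangent_chart M \<phi> ` tangent_over k M V = \<phi> ` V \<times> UNIV"
proof -
  have full: "tangent_chart M \<phi> ` tangent_over k M U = \<phi> ` U \<times> UNIV"
    using bspec[OF full_charts[unfolded has_tangent_charts_def] U] by simp
  have "tangent_proj j \<in> V" if "j \<in> tangent_over k M U" "\<phi> (tangent_proj j) \<in> \<phi> ` V" for j
    using that inj_on_chart[OF U] \<open>V \<subseteq> U\<close> by (auto simp: tangent_over_def inj_on_def)
  then have "tangent_over k M V = {j \<in> tangent_over k M U. fst (tangent_chart M \<phi> j) \<in> \<phi> ` V}"
    using \<open>V \<subseteq> U\<close> unfolding fst_tangent_chart by (auto simp: tangent_over_def)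
  then have "tangent_chart M \<phi> ` tangent_over k M V =
      {z \<in> tangent_chart M \<phi> ` tangent_over k M U. fst z \<in> \<phi> ` V}"
    by blast
  also have "\<dots> = \<phi> ` V \<times> UNIV"
    unfolding full using \<open>V \<subseteq> U\<close> by auto
  finally show ?thesis .
qed

text \<open>
  This is the tangent map of the coordinate change from \<open>\<phi>\<close> to \<open>\<psi>\<close>.
\<close>

definition tangent_change ::
    "'m set \<Rightarrow> ('m \<Rightarrow> 'f) \<Rightarrow> ('m \<Rightarrow> 'f) \<Rightarrow> 'f \<times> 'f \<Rightarrow> 'f \<times> 'f" where
  "tangent_change U \<phi> \<psi> =
     (\<lambda>(x, v). ((\<psi> \<circ> inv_into U \<phi>) x, dir_deriv (model M) (\<psi> \<circ> inv_into U \<phi>) x v))"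

lemma tangent_chart_change:
  assumes U: "(U, \<phi>) \<in> charts M" and V: "(V, \<psi>) \<in> charts M"
    and j: "j \<in> tangent_over k M (U \<inter> V)"
  shows "tangent_chart M \<psi> j = tangent_change U \<phi> \<psi> (tangent_chart M \<phi> j)"
proof -
  have j': "j \<in> tangent_set k M" "tangent_proj j \<in> U" "tangent_proj j \<in> V"
    using j by (auto simp: tangent_over_def)
  obtain p f where f: "f \<in> curves_at k M p" "j = jet k M p f" "tangent_proj j = p"
    by (rule tangent_setE[OF j'(1)])
  then have p: "p \<in> U" "p \<in> V"
    using j' by simp_all
  show ?thesis
    unfolding f(2) tangent_chart_jet[OF f(1) U p(1)] tangent_chart_jet[OF f(1) V p(2)] tangent_change_def
    using inv_into_f_f[OF inj_on_chart[OF U] p(1)] velocity_change[OF f(1) U p(1) V p(2)]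
    by simp
qed

lemma continuous_tangent_change:
  assumes U: "(U, \<phi>) \<in> charts M" and V: "(V, \<psi>) \<in> charts M"
  shows "continuous_map (subtopology (prod_topology model_top model_top) (\<phi> ` (U \<inter> V) \<times> UNIV))
    (prod_topology model_top model_top) (tangent_change U \<phi> \<psi>)"
proof -
  have eq: "subtopology (prod_topology model_top model_top) (\<phi> ` (U \<inter> V) \<times> UNIV) =
      prod_topology (subtopology model_top (\<phi> ` (U \<inter> V))) model_top"
    by (simp add: prod_topology_subtopology(1))
  have kd: "continuous_map (subtopology model_top (\<phi> ` (U \<inter> V))) model_top (\<psi> \<circ> inv_into U \<phi>)"
    "continuous_map (prod_topology (subtopology model_top (\<phi> ` (U \<inter> V))) model_top) model_top
       (\<lambda>(x, v). dir_deriv (model M) (\<psi> \<circ> inv_into U \<phi>) x v)"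
    using transition_keller_differentiable[OF U V]
    by (simp_all only: keller_differentiable_def cont_on_def)
  have "continuous_map (prod_topology (subtopology model_top (\<phi> ` (U \<inter> V))) model_top)
      (prod_topology model_top model_top)
      (\<lambda>z. ((\<psi> \<circ> inv_into U \<phi>) (fst z), (\<lambda>(x, v). dir_deriv (model M) (\<psi> \<circ> inv_into U \<phi>) x v) z))"
    by (intro continuous_map_pairedI kd(2) continuous_map_compose[OF continuous_map_fst kd(1), unfolded o_def[of _ fst]])
  then show ?thesis
    unfolding eq tangent_change_def by (simp add: case_prod_unfold)
qed

section \<open>The topology of the tangent bundle\<close>

lemma mtop_tangent_mfld:
  "tangent_top = topology_generated_by
     {{j \<in> A. c j \<in> W} | A c W. (A, c) \<in> charts (tangent_mfld k M) \<and>
        openin (prod_topology model_top model_top) W}"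
proof -
  have "{{j \<in> tangent_over k M U. tangent_chart M \<phi> j \<in> W} | U \<phi> W.
           (U, \<phi>) \<in> charts M \<and> openin (prod_topology model_top model_top) W} =
      {{j \<in> A. c j \<in> W} | A c W. (A, c) \<in> charts (tangent_mfld k M) \<and>
        openin (prod_topology model_top model_top) W}" (is "?L = ?R")
  proof
    show "?L \<subseteq> ?R"
      by (fastforce simp: tangent_mfld_def)
    show "?R \<subseteq> ?L"
      by (auto simp: tangent_mfld_def)
  qed
  then show ?thesis
    by (simp add: tangent_mfld_def mtopology_of_max_metric)
qed

lemma tangent_atlas_compatible:
  shows "(A, c) \<in> charts (tangent_mfld k M) \<Longrightarrow> inj_on c A"
    and "(A, c) \<in> charts (tangent_mfld k M) \<Longrightarrow> c ` A \<subseteq> topspace (prod_topology model_top model_top)"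
    and "\<lbrakk>(A, c) \<in> charts (tangent_mfld k M); (B, d) \<in> charts (tangent_mfld k M);
      openin (prod_topology model_top model_top) W\<rbrakk>
      \<Longrightarrow> openin (prod_topology model_top model_top) (c ` {j \<in> A \<inter> B. d j \<in> W})"
proof -
  show "inj_on c A" if "(A, c) \<in> charts (tangent_mfld k M)"
    using that inj_on_tangent_chart by (auto simp: tangent_mfld_def)
  show "c ` A \<subseteq> topspace (prod_topology model_top model_top)"
    by simp
  assume "(A, c) \<in> charts (tangent_mfld k M)" "(B, d) \<in> charts (tangent_mfld k M)"
    and W: "openin (prod_topology model_top model_top) W"
  then obtain U \<phi> V \<psi> where U: "(U, \<phi>) \<in> charts M" and V: "(V, \<psi>) \<in> charts M"
    and eq: "A = tangent_over k M U" "c = tangent_chart M \<phi>" "B = tangent_over k M V" "d = tangent_chart M \<psi>"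
    by (auto simp: tangent_mfld_def)
  have op: "openin (prod_topology model_top model_top) (\<phi> ` (U \<inter> V) \<times> UNIV)"
    using openin_chart_overlap[OF U openin_chart[OF V]]
    using openin_topspace[of model_top] by (simp add: openin_prod_Times_iff)
  have "c ` {j \<in> A \<inter> B. d j \<in> W} =
      {z \<in> tangent_chart M \<phi> ` tangent_over k M (U \<inter> V). tangent_change U \<phi> \<psi> z \<in> W}"
    unfolding eq tangent_over_Int using tangent_chart_change[OF U V] by auto
  also have "\<dots> = {z \<in> topspace (subtopology (prod_topology model_top model_top) (\<phi> ` (U \<inter> V) \<times> UNIV)).
      tangent_change U \<phi> \<psi> z \<in> W}"
    using tangent_chart_image[OF U, of "U \<inter> V"] by simp
  finally have "openin (subtopology (prod_topology model_top model_top) (\<phi> ` (U \<inter> V) \<times> UNIV))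
      (c ` {j \<in> A \<inter> B. d j \<in> W})"
    using continuous_tangent_change[OF U V] W by (simp only: continuous_map)
  then show "openin (prod_topology model_top model_top) (c ` {j \<in> A \<inter> B. d j \<in> W})"
    by (simp add: openin_open_subtopology[OF op])
qed

lemma tangent_topology_by_charts:
  shows "topspace tangent_top = (\<Union>(A, c)\<in>charts (tangent_mfld k M). A)"
    and "(A, c) \<in> charts (tangent_mfld k M) \<Longrightarrow> openin tangent_top A"
    and "(A, c) \<in> charts (tangent_mfld k M) \<Longrightarrow> openin (prod_topology model_top model_top) (c ` A)"
    and "(A, c) \<in> charts (tangent_mfld k M) \<Longrightarrow>
      homeomorphic_map (subtopology tangent_top A) (subtopology (prod_topology model_top model_top) (c ` A)) c"
proof -
  note atlas = topology_generated_by_charts[of "charts (tangent_mfld k M)" "prod_topology model_top model_top",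
      folded mtop_tangent_mfld]
  show "topspace tangent_top = (\<Union>(A, c)\<in>charts (tangent_mfld k M). A)"
    by (rule atlas(1)) (fact tangent_atlas_compatible)+
  assume Ac: "(A, c) \<in> charts (tangent_mfld k M)"
  show "openin tangent_top A"
    by (rule atlas(2)[OF _ _ _ Ac]) (fact tangent_atlas_compatible)+
  show "openin (prod_topology model_top model_top) (c ` A)"
    by (rule atlas(3)[OF _ _ _ Ac]) (fact tangent_atlas_compatible)+
  show "homeomorphic_map (subtopology tangent_top A) (subtopology (prod_topology model_top model_top) (c ` A)) c"
    by (rule atlas(4)[OF _ _ _ Ac]) (fact tangent_atlas_compatible)+
qed

lemma tangent_chart_in_charts:
  "(U, \<phi>) \<in> charts M \<Longrightarrow> (tangent_over k M U, tangent_chart M \<phi>) \<in> charts (tangent_mfld k M)"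
  by (force simp: tangent_mfld_def)

lemma topspace_tangent [simp]: "topspace tangent_top = tangent_set k M"
proof -
  have "topspace tangent_top = (\<Union>(A, c)\<in>charts (tangent_mfld k M). A)"
    by (rule tangent_topology_by_charts(1))
  also have "\<dots> = (\<Union>(U, \<phi>)\<in>charts M. tangent_over k M U)"
    by (auto simp: tangent_mfld_def)
  also have "\<dots> = tangent_set k M"
    using tangent_proj_in_topspace topspace_charts by (fastforce simp: tangent_over_def)
  finally show ?thesis .
qed

lemma openin_tangent_over: "(U, \<phi>) \<in> charts M \<Longrightarrow> openin tangent_top (tangent_over k M U)"
  by (rule tangent_topology_by_charts(2)[OF tangent_chart_in_charts])

end

section \<open>Continuous maps between manifolds\<close>

text \<open>
  For maps of class \<open>0\<close> only the topological part of an atlas matters: charts are homeomorphisms of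
  open sets onto their images.
\<close>

definition topological_charts :: "('m, 'f) mfld \<Rightarrow> bool" where
  "topological_charts N \<longleftrightarrow> (\<forall>(U, \<phi>)\<in>charts N. openin (mtop N) U \<and>
     homeomorphic_map (subtopology (mtop N) U) (subtopology (mtopology_of (model N)) (\<phi> ` U)) \<phi>)"

lemma topological_chartsD:
  assumes "topological_charts N" "(U, \<phi>) \<in> charts N"
  shows "openin (mtop N) U"
    and "homeomorphic_map (subtopology (mtop N) U) (subtopology (mtopology_of (model N)) (\<phi> ` U)) \<phi>"
  using assms by (auto simp: topological_charts_def)

lemma MC_map_0I:
  assumes M: "topological_charts M" and N: "topological_charts N"
    and f: "continuous_map (mtop M) (mtop N) f"
  shows "MC_map 0 M N f"
proof -
  have "cont_on (model M) (model N) (\<phi> ` (U \<inter> f -` V)) (\<psi> \<circ> f \<circ> inv_into U \<phi>)"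
    if U: "(U, \<phi>) \<in> charts M" and V: "(V, \<psi>) \<in> charts N" for U \<phi> V \<psi>
  proof -
    let ?S = "\<phi> ` (U \<inter> f -` V)"
    have ts: "topspace (subtopology (mtop M) U) = U"
      using openin_subset[OF topological_chartsD(1)[OF M U]] by auto
    have hom: "homeomorphic_maps (subtopology (mtop M) U) (subtopology (mtopology_of (model M)) (\<phi> ` U))
        \<phi> (inv_into U \<phi>)"
      using homeomorphic_maps_inv_into[OF topological_chartsD(2)[OF M U]] by (simp only: ts)
    then have "continuous_map (subtopology (mtopology_of (model M)) (\<phi> ` U)) (mtop M) (inv_into U \<phi>)"
      by (simp add: homeomorphic_maps_def continuous_map_in_subtopology)
    then have "continuous_map (subtopology (mtopology_of (model M)) ?S) (mtop M) (inv_into U \<phi>)"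
      by (rule continuous_map_from_subtopology_mono) blast
    then have "continuous_map (subtopology (mtopology_of (model M)) ?S) (mtop N) (f \<circ> inv_into U \<phi>)"
      by (rule continuous_map_compose[OF _ f])
    moreover have "f (inv_into U \<phi> y) \<in> V" if y: "y \<in> ?S" for y
    proof -
      obtain u where u: "y = \<phi> u" "u \<in> U" "f u \<in> V" using y by blast
      have "inv_into U \<phi> (\<phi> u) = u"
        using hom u(2) ts by (simp add: homeomorphic_maps_def)
      then show ?thesis using u by simp
    qed
    ultimately have "continuous_map (subtopology (mtopology_of (model M)) ?S) (subtopology (mtop N) V)
        (f \<circ> inv_into U \<phi>)"
      by (auto simp: continuous_map_in_subtopology)
    moreover have "continuous_map (subtopology (mtop N) V) (mtopology_of (model N)) \<psi>"
      using homeomorphic_imp_continuous_map[OF topological_chartsD(2)[OF N V]]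
      by (simp add: continuous_map_in_subtopology)
    ultimately show ?thesis
      unfolding cont_on_def o_assoc[symmetric] by (rule continuous_map_compose)
  qed
  then show ?thesis
    using f by (auto simp: MC_map_def)
qed

lemma topological_charts_vec_mfld: "topological_charts (vec_mfld E)" if "mspace E = UNIV"
proof -
  have "homeomorphic_map (mtopology_of E) (mtopology_of E) (\<lambda>x. x)"
    using homeomorphic_map_id[of "mtopology_of E" "mtopology_of E"] by (simp add: id_def)
  moreover have "openin (mtopology_of E) UNIV"
    using openin_topspace[of "mtopology_of E"] that by simp
  ultimately show ?thesis
    by (simp add: topological_charts_def vec_mfld_def)
qed

lemma topological_charts_open_submfld:
  assumes N: "topological_charts N" and W: "openin (mtop N) W"
  shows "topological_charts (open_submfld N W)"
  unfolding topological_charts_def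
proof (clarsimp simp: open_submfld_def)
  fix U \<phi> assume U: "(U, \<phi>) \<in> charts N"
  note UN = topological_chartsD[OF N U]
  have ts: "topspace (subtopology (mtop N) U) = U"
    using openin_subset[OF UN(1)] by auto
  have "openin (subtopology (mtop N) W) (U \<inter> W)"
    using UN(1) W by (simp add: openin_open_subtopology openin_Int)
  moreover have "homeomorphic_map (subtopology (subtopology (mtop N) U) W)
      (subtopology (subtopology (mtopology_of (model N)) (\<phi> ` U)) (\<phi> ` (U \<inter> W))) \<phi>"
  proof (rule homeomorphic_map_subtopologies[OF UN(2)])
    show "\<phi> ` (topspace (subtopology (mtop N) U) \<inter> W) =
        topspace (subtopology (mtopology_of (model N)) (\<phi> ` U)) \<inter> \<phi> ` (U \<inter> W)"
      unfolding homeomorphic_imp_surjective_map[OF UN(2), symmetric] unfolding ts by blast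
  qed
  moreover have "\<phi> ` U \<inter> \<phi> ` (U \<inter> W) = \<phi> ` (U \<inter> W)" "W \<inter> (U \<inter> W) = U \<inter> W" by blast+
  ultimately show "openin (subtopology (mtop N) W) (U \<inter> W) \<and>
      homeomorphic_map (subtopology (subtopology (mtop N) W) (U \<inter> W))
        (subtopology (mtopology_of (model N)) (\<phi> ` (U \<inter> W))) \<phi>"
    by (simp only: subtopology_subtopology)
qed

lemma homeomorphic_map_prod_id:
  assumes "homeomorphic_map X Y f"
  shows "homeomorphic_map (prod_topology X Z) (prod_topology Y Z) (\<lambda>(x, z). (f x, z))"
proof -
  obtain g where "homeomorphic_maps X Y f g"
    using assms homeomorphic_map_maps by blast
  moreover have "homeomorphic_maps Z Z (\<lambda>z. z) (\<lambda>z. z)"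
    by (simp add: homeomorphic_maps_def)
  ultimately have "homeomorphic_maps (prod_topology X Z) (prod_topology Y Z)
      (\<lambda>(x, z). (f x, z)) (\<lambda>(y, z). (g y, z))"
    unfolding homeomorphic_maps_prod by blast
  then show ?thesis
    by (rule homeomorphic_maps_imp_map)
qed

lemma subtopology_Times_UNIV:
  assumes "topspace Y = UNIV"
  shows "subtopology (prod_topology X Y) (S \<times> UNIV) = prod_topology (subtopology X S) Y"
  using prod_topology_subtopology(1)[of X S Y] assms by simp

lemma topological_charts_times_mfld:
  fixes N :: "('m, 'f) mfld" and E :: "'e metric"
  assumes N: "topological_charts N" and E: "mspace E = UNIV"
  shows "topological_charts (times_mfld N E)"
  unfolding topological_charts_def
proof (clarsimp simp: times_mfld_def mtopology_of_max_metric)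
  fix U \<phi> assume U: "(U, \<phi>) \<in> charts N"
  note UN = topological_chartsD[OF N U]
  have "openin (prod_topology (mtop N) (mtopology_of E)) (U \<times> UNIV)"
    using UN(1) openin_topspace[of "mtopology_of E"] E by (simp add: openin_prod_Times_iff)
  moreover have "homeomorphic_map (subtopology (prod_topology (mtop N) (mtopology_of E)) (U \<times> UNIV))
      (subtopology (prod_topology (mtopology_of (model N)) (mtopology_of E)) (\<phi> ` U \<times> UNIV))
      (\<lambda>(x, v). (\<phi> x, v))"
    using homeomorphic_map_prod_id[OF UN(2)] E by (simp add: subtopology_Times_UNIV)
  moreover have "(\<lambda>(x, v). (\<phi> x, v)) ` (U \<times> UNIV) = \<phi> ` U \<times> (UNIV :: 'e set)" by force
  ultimately show "openin (prod_topology (mtop N) (mtopology_of E)) (U \<times> UNIV) \<and>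
      homeomorphic_map (subtopology (prod_topology (mtop N) (mtopology_of E)) (U \<times> UNIV))
        (subtopology (prod_topology (mtopology_of (model N)) (mtopology_of E))
           ((\<lambda>(x, v). (\<phi> x, v)) ` (U \<times> UNIV))) (\<lambda>(x, v). (\<phi> x, v))"
    by (simp only:)
qed

lemma MC_manifold_0I:
  assumes N: "topological_charts N" and "frechet (model N)" "Hausdorff_space (mtop N)"
    "second_countable (mtop N)" "(\<Union>(U, \<phi>)\<in>charts N. U) = topspace (mtop N)"
    and "\<And>U \<phi>. (U, \<phi>) \<in> charts N \<Longrightarrow> openin (mtopology_of (model N)) (\<phi> ` U)"
  shows "MC_manifold 0 N"
proof -
  \<comment> \<open>The coordinate changes are the expressions of the identity map in charts.\<close>
  have "MC_map 0 N N (\<lambda>x. x)"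
    by (rule MC_map_0I[OF N N]) simp
  then have "MC_on 0 (model N) (model N) (\<phi> ` (U \<inter> V)) (\<psi> \<circ> inv_into U \<phi>)"
    if "(U, \<phi>) \<in> charts N" "(V, \<psi>) \<in> charts N" for U \<phi> V \<psi>
    using that by (force simp: MC_map_def o_def vimage_def)
  then show ?thesis
    using assms topological_chartsD[OF N] unfolding MC_manifold_def by auto
qed

section \<open>Transport of the Frechet structure\<close>

text \<open>
  A bijection onto a Frechet space that respects the operations carries the metric back, which makes the
  domain a Frechet space homeomorphic to the given one.
\<close>

lemma frechet_on_transport:
  assumes F: "frechet F" and h: "bij_betw h S UNIV"
    and add: "\<And>x y. \<lbrakk>x \<in> S; y \<in> S\<rbrakk> \<Longrightarrow> add x y \<in> S \<and> h (add x y) = h x + h y"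
    and smul: "\<And>a x. x \<in> S \<Longrightarrow> smul a x \<in> S \<and> h (smul a x) = a *\<^sub>R h x"
  obtains \<rho> z where "frechet_on add z smul \<rho>" "mspace \<rho> = S"
    "homeomorphic_map (mtopology_of \<rho>) (mtopology_of F) h"
proof -
  have inj: "x = y \<longleftrightarrow> h x = h y" if "x \<in> S" "y \<in> S" for x y
    using h that by (auto simp: bij_betw_def inj_on_def)
  define g where "g = inv_into S h"
  have g: "g v \<in> S" "h (g v) = v" for v
    using h unfolding g_def bij_betw_def by (simp_all add: inv_into_into f_inv_into_f)
  have gh: "g (h x) = x" if "x \<in> S" for x
    using inj[OF g(1) that] g(2) by simp
  define \<rho> where "\<rho> = metric (S, \<lambda>x y. mdist F (h x) (h y))"
  have FU: "mspace F = UNIV" by (rule mspace_frechet[OF F])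
  have MS: "Metric_space S (\<lambda>x y. mdist F (h x) (h y))"
    by unfold_locales (auto simp: FU mdist_commute inj intro: mdist_triangle)
  have sp: "mspace \<rho> = S" and di: "mdist \<rho> = (\<lambda>x y. mdist F (h x) (h y))"
    using Metric_space.mspace_metric[OF MS] Metric_space.mdist_metric[OF MS] by (simp_all add: \<rho>_def)
  have cont_h: "continuous_map (mtopology_of \<rho>) (mtopology_of F) h"
    unfolding continuous_map
  proof (intro conjI allI impI)
    fix W assume "openin (mtopology_of F) W"
    then have W: "\<forall>v\<in>W. \<exists>r>0. \<forall>w. mdist F v w < r \<longrightarrow> w \<in> W"
      by (simp add: openin_mtopology_of_ball FU)
    show "openin (mtopology_of \<rho>) {x \<in> topspace (mtopology_of \<rho>). h x \<in> W}"
      unfolding openin_mtopology_of_ball topspace_mtopology_of sp di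
    proof (intro conjI ballI)
      fix x assume "x \<in> {x \<in> S. h x \<in> W}"
      then obtain r where "r > 0" "\<forall>w. mdist F (h x) w < r \<longrightarrow> w \<in> W"
        using W by auto
      then show "\<exists>r>0. \<forall>y\<in>S. mdist F (h x) (h y) < r \<longrightarrow> y \<in> {x \<in> S. h x \<in> W}"
        by (intro exI[of _ r]) auto
    qed blast
  qed (simp add: FU)
  have cont_g: "continuous_map (mtopology_of F) (mtopology_of \<rho>) g"
    unfolding continuous_map
  proof (intro conjI allI impI)
    show "g ` topspace (mtopology_of F) \<subseteq> topspace (mtopology_of \<rho>)"
      using g(1) sp by auto
    fix W assume "openin (mtopology_of \<rho>) W"
    then have W: "\<forall>x\<in>W. \<exists>r>0. \<forall>y\<in>S. mdist F (h x) (h y) < r \<longrightarrow> y \<in> W"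
      by (simp add: openin_mtopology_of_ball sp di)
    show "openin (mtopology_of F) {v \<in> topspace (mtopology_of F). g v \<in> W}"
      unfolding openin_mtopology_of_ball topspace_mtopology_of FU
    proof (intro conjI ballI)
      fix v assume "v \<in> {v \<in> UNIV. g v \<in> W}"
      then obtain r where r: "r > 0" "\<forall>y\<in>S. mdist F (h (g v)) (h y) < r \<longrightarrow> y \<in> W"
        using W by auto
      show "\<exists>r>0. \<forall>w\<in>UNIV. mdist F v w < r \<longrightarrow> w \<in> {v \<in> UNIV. g v \<in> W}"
      proof (intro exI[of _ r] conjI ballI impI r(1))
        fix w assume "mdist F v w < r"
        then show "w \<in> {v \<in> UNIV. g v \<in> W}"
          using bspec[OF r(2) g(1)[of w]] by (simp add: g(2))
      qed
    qed simp
  qed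
  have hom: "homeomorphic_maps (mtopology_of \<rho>) (mtopology_of F) h g"
    using cont_h cont_g by (simp add: homeomorphic_maps_def sp FU gh g)
  have ops: "vector_space_ops S add (g 0) smul"
    unfolding vector_space_ops_def
  proof (intro conjI ballI allI)
    fix x assume x: "x \<in> S"
    show "\<exists>y\<in>S. add x y = g 0"
      by (rule bexI[of _ "g (- h x)"]) (simp_all add: inj add x g)
  qed (simp_all add: inj add smul g algebra_simps)
  have complete: "mcomplete_of \<rho>"
  proof -
    interpret R: Metric_space "mspace \<rho>" "mdist \<rho>" by (rule Metric_space_mspace_mdist)
    interpret F: Metric_space "mspace F" "mdist F" by (rule Metric_space_mspace_mdist)
    show ?thesis
      unfolding mcomplete_of_def R.mcomplete_def
    proof (intro allI impI)
      fix \<sigma> assume "R.MCauchy \<sigma>"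
      then have "F.MCauchy (h \<circ> \<sigma>)"
        unfolding R.MCauchy_def F.MCauchy_def by (simp add: di FU)
      then obtain v where "limitin (mtopology_of F) (h \<circ> \<sigma>) v sequentially"
        using mcomplete_frechet[OF F] unfolding mcomplete_of_def F.mcomplete_def mtopology_of_def by blast
      from continuous_map_limit[OF cont_g this]
      have "limitin (mtopology_of \<rho>) (g \<circ> (h \<circ> \<sigma>)) (g v) sequentially" .
      moreover have "range \<sigma> \<subseteq> mspace \<rho>"
        using \<open>R.MCauchy \<sigma>\<close> unfolding R.MCauchy_def by blast
      then have "g \<circ> (h \<circ> \<sigma>) = \<sigma>"
        using gh by (auto simp: sp fun_eq_iff)
      ultimately show "\<exists>x. limitin R.mtopology \<sigma> x sequentially"
        unfolding mtopology_of_def by auto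
    qed
  qed
  have cont_smul: "continuous_map (prod_topology euclideanreal (mtopology_of \<rho>)) (mtopology_of \<rho>)
      (\<lambda>(a, x). smul a x)"
  proof -
    have "continuous_map (prod_topology euclideanreal (mtopology_of \<rho>))
        (prod_topology euclideanreal (mtopology_of F)) (\<lambda>z. (fst z, h (snd z)))"
      by (intro continuous_map_pairedI continuous_map_fst
          continuous_map_compose[OF continuous_map_snd cont_h, unfolded o_def])
    from continuous_map_compose[OF this continuous_map_compose[OF continuous_scaleR[OF F] cont_g]]
    show ?thesis
    proof (rule continuous_map_eq)
      fix z assume "z \<in> topspace (prod_topology euclideanreal (mtopology_of \<rho>))"
      then have "snd z \<in> S" by (auto simp: sp)
      then show "(g \<circ> (\<lambda>(a, x). a *\<^sub>R x) \<circ> (\<lambda>z. (fst z, h (snd z)))) z = (\<lambda>(a, x). smul a x) z"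
        by (simp add: case_prod_unfold inj smul g)
    qed
  qed
  have "frechet_on add (g 0) smul \<rho>"
    unfolding frechet_on_def sp di
  proof (intro conjI ballI allI impI)
    fix x y w assume "x \<in> S" "y \<in> S" "w \<in> S"
    then show "mdist F (h (add x w)) (h (add y w)) = mdist F (h x) (h y)"
      by (simp add: add mdist_translate[OF F])
  next
    fix r :: real and x y and a b :: real
    assume "x \<in> S" "y \<in> S"
      "mdist F (h x) (h (g 0)) < r \<and> mdist F (h y) (h (g 0)) < r \<and> \<bar>a\<bar> + \<bar>b\<bar> \<le> 1"
    then show "mdist F (h (add (smul a x) (smul b y))) (h (g 0)) < r"
      by (simp add: add smul g mdist_absconvex[OF F])
  qed (fact ops complete cont_smul)+
  then show thesis
    using that[OF _ sp homeomorphic_maps_imp_map[OF hom]] by blast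
qed

lemma topology_eq_homeomorphic_map:
  assumes "homeomorphic_map X Z h" "homeomorphic_map Y Z h" "topspace X = topspace Y"
  shows "X = Y"
proof (rule topology_eq[THEN iffD2], rule allI)
  fix S
  show "openin X S \<longleftrightarrow> openin Y S"
  proof (cases "S \<subseteq> topspace X")
    case True
    then show ?thesis
      using homeomorphic_map_openness[OF assms(1), of S] homeomorphic_map_openness[OF assms(2), of S]
        assms(3) by simp
  next
    case False
    then show ?thesis
      using openin_subset[of X S] openin_subset[of Y S] assms(3) by auto
  qed
qed

section \<open>Local trivializations of the tangent bundle\<close>

context tangent_atlas
begin

definition principal_part :: "('m \<Rightarrow> 'f) \<Rightarrow> (real \<Rightarrow> 'm) set \<Rightarrow> 'f" where
  "principal_part \<phi> j = snd (tangent_chart M \<phi> j)"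

lemma subtopology_prod_model:
  "subtopology (prod_topology X model_top) (S \<times> UNIV) = prod_topology (subtopology X S) model_top"
  by (simp add: subtopology_Times_UNIV)

lemma homeomorphic_map_trivialization:
  assumes U: "(U, \<phi>) \<in> charts M"
  shows "homeomorphic_map (subtopology tangent_top (tangent_over k M U))
    (prod_topology (subtopology (mtop M) U) model_top) (\<lambda>j. (tangent_proj j, principal_part \<phi> j))"
proof -
  have T: "homeomorphic_map (subtopology tangent_top (tangent_over k M U))
      (prod_topology (subtopology model_top (\<phi> ` U)) model_top) (tangent_chart M \<phi>)"
    using tangent_topology_by_charts(4)[OF tangent_chart_in_charts[OF U]]
    by (simp only: tangent_chart_image[OF U order_refl] subtopology_prod_model)
  have "homeomorphic_maps (subtopology (mtop M) U) (subtopology model_top (\<phi> ` U)) \<phi> (inv_into U \<phi>)"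
    using homeomorphic_maps_inv_into[OF homeomorphic_map_chart[OF U]]
    by (simp only: topspace_subtopology_chart[OF U])
  then have "homeomorphic_map (subtopology model_top (\<phi> ` U)) (subtopology (mtop M) U) (inv_into U \<phi>)"
    by (simp only: homeomorphic_maps_map)
  from homeomorphic_map_compose[OF T homeomorphic_map_prod_id[OF this]]
  show ?thesis
  proof (rule homeomorphic_map_eq)
    fix j assume "j \<in> topspace (subtopology tangent_top (tangent_over k M U))"
    then have "tangent_proj j \<in> U" by (simp add: tangent_over_def)
    then show "((\<lambda>(x, v). (inv_into U \<phi> x, v)) \<circ> tangent_chart M \<phi>) j = (tangent_proj j, principal_part \<phi> j)"
      using inv_into_f_f[OF inj_on_chart[OF U]]
      by (simp add: principal_part_def tangent_chart_def)
  qed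
qed

lemma continuous_tangent_proj: "continuous_map tangent_top (mtop M) tangent_proj"
proof (rule pasting_lemma[where I = "charts M" and T = "\<lambda>(U, \<phi>). tangent_over k M U" and f = "\<lambda>_. tangent_proj"])
  show "openin tangent_top (case i of (U, \<phi>) \<Rightarrow> tangent_over k M U)" if "i \<in> charts M" for i
    using that openin_tangent_over by (cases i) simp
  show "continuous_map (subtopology tangent_top (case i of (U, \<phi>) \<Rightarrow> tangent_over k M U)) (mtop M) tangent_proj"
    if "i \<in> charts M" for i
  proof -
    obtain U \<phi> where i: "i = (U, \<phi>)" by force
    have U: "(U, \<phi>) \<in> charts M" using that i by simp
    have "continuous_map (subtopology tangent_top (tangent_over k M U)) (subtopology (mtop M) U)
        (fst \<circ> (\<lambda>j. (tangent_proj j, principal_part \<phi> j)))"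
      by (rule continuous_map_compose[OF homeomorphic_imp_continuous_map[OF homeomorphic_map_trivialization[OF U]]
            continuous_map_fst])
    then show ?thesis
      by (simp add: i o_def continuous_map_in_subtopology)
  qed
  show "\<exists>i. i \<in> charts M \<and> j \<in> (case i of (U, \<phi>) \<Rightarrow> tangent_over k M U) \<and> tangent_proj j = tangent_proj j"
    if "j \<in> topspace tangent_top" for j
  proof -
    have j: "j \<in> tangent_set k M" using that by simp
    obtain U \<phi> where "(U, \<phi>) \<in> charts M" "tangent_proj j \<in> U"
      by (rule chart_at[OF tangent_proj_in_topspace[OF j]])
    then show ?thesis using j by (intro exI[of _ "(U, \<phi>)"]) (simp add: tangent_over_def)
  qed
qed simp

text \<open>
  Jets over different points are separated by pulling back neighbourhoods of the base points, jets over
  the same point inside a single chart.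
\<close>

lemma Hausdorff_tangent: "Hausdorff_space tangent_top"
  unfolding Hausdorff_space_def
proof (intro allI impI)
  fix i j assume ij: "i \<in> topspace tangent_top \<and> j \<in> topspace tangent_top \<and> i \<noteq> j"
  then have i: "i \<in> tangent_set k M" and j: "j \<in> tangent_set k M" by simp_all
  show "\<exists>A B. openin tangent_top A \<and> openin tangent_top B \<and> i \<in> A \<and> j \<in> B \<and> disjnt A B"
  proof (cases "tangent_proj i = tangent_proj j")
    case False
    have "Hausdorff_space (mtop M)" using manifold by (simp add: MC_manifold_def)
    then obtain A B where AB: "openin (mtop M) A" "openin (mtop M) B" "tangent_proj i \<in> A"
      "tangent_proj j \<in> B" "disjnt A B"
      using tangent_proj_in_topspace[OF i] tangent_proj_in_topspace[OF j] False
      unfolding Hausdorff_space_def by meson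
    have "openin tangent_top {l \<in> topspace tangent_top. tangent_proj l \<in> A}"
      "openin tangent_top {l \<in> topspace tangent_top. tangent_proj l \<in> B}"
      using continuous_tangent_proj AB(1,2) by (simp_all only: continuous_map)
    then show ?thesis
      using AB(3-) i j
      by (intro exI[of _ "{l \<in> topspace tangent_top. tangent_proj l \<in> A}"]
            exI[of _ "{l \<in> topspace tangent_top. tangent_proj l \<in> B}"]) (auto simp: disjnt_iff)
  next
    case True
    obtain U \<phi> where U: "(U, \<phi>) \<in> charts M" "tangent_proj i \<in> U"
      by (rule chart_at[OF tangent_proj_in_topspace[OF i]])
    have "Hausdorff_space (prod_topology (subtopology (mtop M) U) model_top)"
      using manifold Hausdorff_mtopology_of[of "model M"]
      by (simp add: Hausdorff_space_prod_topology Hausdorff_space_subtopology MC_manifold_def)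
    then have "Hausdorff_space (subtopology tangent_top (tangent_over k M U))"
      using homeomorphic_Hausdorff_space[OF homeomorphic_map_imp_homeomorphic_space[OF
            homeomorphic_map_trivialization[OF U(1)]]] by simp
    moreover have "i \<in> tangent_over k M U" "j \<in> tangent_over k M U"
      using U(2) True i j by (simp_all add: tangent_over_def)
    ultimately obtain A B where "openin (subtopology tangent_top (tangent_over k M U)) A"
      "openin (subtopology tangent_top (tangent_over k M U)) B" "i \<in> A" "j \<in> B" "disjnt A B"
      using ij unfolding Hausdorff_space_def topspace_subtopology by (metis IntI)
    then show ?thesis
      by (auto simp: openin_open_subtopology[OF openin_tangent_over[OF U(1)]])
  qed
qed

text \<open>
  The base is a Lindelof space, so countably many chart domains cover it. Empty ones are removed because
  only a nonempty domain forces the model to be second countable.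
\<close>

lemma second_countable_tangent: "second_countable tangent_top"
proof -
  have scM: "second_countable (mtop M)"
    using manifold by (simp add: MC_manifold_def)
  have "\<forall>U\<in>fst ` charts M. openin (mtop M) U"
    using openin_chart by auto
  moreover have "\<Union>(fst ` charts M) = topspace (mtop M)"
    using topspace_charts by (simp add: case_prod_unfold)
  ultimately obtain \<V> where V: "countable \<V>" "\<V> \<subseteq> fst ` charts M" "\<Union>\<V> = topspace (mtop M)"
    using second_countable_imp_Lindelof_space[OF scM] unfolding Lindelof_space_def by meson
  show ?thesis
  proof (rule second_countable_Union_open[where I = "\<V> - {{}}" and A = "tangent_over k M"])
    show "countable (\<V> - {{}})" using V(1) by simp
    show "topspace tangent_top \<subseteq> (\<Union>U\<in>\<V> - {{}}. tangent_over k M U)"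
      using tangent_proj_in_topspace V(3) by (fastforce simp: tangent_over_def)
    fix U assume "U \<in> \<V> - {{}}"
    then obtain \<phi> where U: "(U, \<phi>) \<in> charts M" "U \<noteq> {}"
      using V(2) by force
    show "openin tangent_top (tangent_over k M U)"
      by (rule openin_tangent_over[OF U(1)])
    have scU: "second_countable (subtopology (mtop M) U)"
      by (rule second_countable_subtopology[OF scM])
    then have "second_countable (subtopology model_top (\<phi> ` U))"
      using homeomorphic_space_second_countability[OF homeomorphic_map_imp_homeomorphic_space[OF
            homeomorphic_map_chart[OF U(1)]]] by simp
    then have "second_countable model_top"
      using second_countable_frechet[OF frechet_model openin_image_chart[OF U(1)]] U(2) by simp
    then have "second_countable (prod_topology (subtopology (mtop M) U) model_top)"
      by (rule second_countable_prod_topology[OF scU])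
    then show "second_countable (subtopology tangent_top (tangent_over k M U))"
      using homeomorphic_space_second_countability[OF homeomorphic_map_imp_homeomorphic_space[OF
            homeomorphic_map_trivialization[OF U(1)]]] by simp
  qed
qed

lemma model_tangent [simp]: "model (tangent_mfld k M) = max_metric (model M) (model M)"
  by (simp add: tangent_mfld_def)

lemma topological_charts_tangent: "topological_charts (tangent_mfld k M)"
  using tangent_topology_by_charts(2,4) by (auto simp: topological_charts_def mtopology_of_max_metric)

lemma topological_charts_base: "topological_charts M"
  using openin_chart homeomorphic_map_chart by (auto simp: topological_charts_def)

lemma MC_manifold_0_base: "MC_manifold 0 M"
  using manifold openin_image_chart
  by (intro MC_manifold_0I[OF topological_charts_base]) (simp_all add: MC_manifold_def)

lemma MC_manifold_0_tangent: "MC_manifold 0 (tangent_mfld k M)"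
proof (rule MC_manifold_0I[OF topological_charts_tangent _ Hausdorff_tangent second_countable_tangent])
  show "frechet (model (tangent_mfld k M))"
    by (simp add: frechet_max_metric[OF frechet_model frechet_model])
  show "(\<Union>(A, c)\<in>charts (tangent_mfld k M). A) = topspace tangent_top"
    by (rule tangent_topology_by_charts(1)[symmetric])
  show "openin (mtopology_of (model (tangent_mfld k M))) (c ` A)" if "(A, c) \<in> charts (tangent_mfld k M)" for A c
    using tangent_topology_by_charts(3)[OF that] by (simp add: mtopology_of_max_metric)
qed

section \<open>The fibers of the tangent bundle\<close>

abbreviation tangent_space :: "'m \<Rightarrow> (real \<Rightarrow> 'm) set set" where
  "tangent_space \<equiv> fiber (tangent_mfld k M) tangent_proj"

lemma tangent_space_subset:
  assumes "m \<in> U" shows "tangent_space m \<subseteq> tangent_over k M U"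
  using assms by (auto simp: fiber_def tangent_over_def)

lemma homeomorphic_map_principal_part:
  assumes U: "(U, \<phi>) \<in> charts M" "m \<in> U"
  shows "homeomorphic_map (subtopology tangent_top (tangent_space m)) model_top (principal_part \<phi>)"
proof -
  let ?triv = "\<lambda>j. (tangent_proj j, principal_part \<phi> j)"
  note triv = homeomorphic_map_trivialization[OF U(1)]
  have m: "m \<in> topspace (mtop M)"
    using openin_subset[OF openin_chart[OF U(1)]] U(2) by blast
  have "homeomorphic_map (subtopology (subtopology tangent_top (tangent_over k M U)) (tangent_space m))
      (subtopology (prod_topology (subtopology (mtop M) U) model_top) ({m} \<times> UNIV)) ?triv"
  proof (rule homeomorphic_map_subtopologies_alt[OF triv])
    fix j assume "j \<in> topspace (subtopology tangent_top (tangent_over k M U))"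
    then show "?triv j \<in> {m} \<times> UNIV \<longleftrightarrow> j \<in> tangent_space m"
      by (auto simp: fiber_def)
  qed
  moreover have "subtopology (subtopology tangent_top (tangent_over k M U)) (tangent_space m) =
      subtopology tangent_top (tangent_space m)"
    using tangent_space_subset[OF U(2)] by (simp add: subtopology_subtopology inf.absorb2)
  moreover have "subtopology (prod_topology (subtopology (mtop M) U) model_top) ({m} \<times> UNIV) =
      prod_topology (subtopology (mtop M) {m}) model_top"
    using U(2) by (simp add: subtopology_prod_model subtopology_subtopology)
  ultimately have triv_m: "homeomorphic_map (subtopology tangent_top (tangent_space m))
      (prod_topology (subtopology (mtop M) {m}) model_top) ?triv"
    by simp
  have "homeomorphic_maps (prod_topology (subtopology (mtop M) {m}) model_top) model_top snd (\<lambda>v. (m, v))"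
    unfolding homeomorphic_maps_def using m
    by (auto intro!: continuous_map_snd continuous_map_pairedI)
  from homeomorphic_map_compose[OF triv_m homeomorphic_maps_imp_map[OF this]]
  show ?thesis
    by (simp add: o_def)
qed

lemma topspace_tangent_space: "topspace (subtopology tangent_top (tangent_space m)) = tangent_space m"
  by (auto simp: fiber_def)

lemma bij_betw_principal_part:
  assumes U: "(U, \<phi>) \<in> charts M" "m \<in> U"
  shows "bij_betw (principal_part \<phi>) (tangent_space m) UNIV"
  using homeomorphic_imp_injective_map[OF homeomorphic_map_principal_part[OF U]]
    homeomorphic_imp_surjective_map[OF homeomorphic_map_principal_part[OF U]]
  unfolding topspace_tangent_space bij_betw_def by simp

lemma principal_part_inv_into:
  assumes U: "(U, \<phi>) \<in> charts M" "m \<in> U"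
  shows "inv_into (tangent_space m) (principal_part \<phi>) v \<in> tangent_space m"
    and "principal_part \<phi> (inv_into (tangent_space m) (principal_part \<phi>) v) = v"
  using bij_betw_principal_part[OF U] unfolding bij_betw_def
  by (simp_all add: inv_into_into f_inv_into_f)

lemma principal_part_change:
  assumes U: "(U, \<phi>) \<in> charts M" "m \<in> U" and V: "(V, \<psi>) \<in> charts M" "m \<in> V"
    and j: "j \<in> tangent_space m"
  shows "principal_part \<psi> j = dir_deriv (model M) (\<psi> \<circ> inv_into U \<phi>) (\<phi> m) (principal_part \<phi> j)"
proof -
  have "tangent_proj j = m" using j by (simp add: fiber_def)
  moreover have "j \<in> tangent_over k M (U \<inter> V)"
    using tangent_space_subset[of m "U \<inter> V"] U(2) V(2) j by blast
  ultimately show ?thesis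
    using tangent_chart_change[OF U(1) V(1)]
    by (simp add: principal_part_def tangent_change_def tangent_chart_def)
qed

lemma linear_coordinate_change:
  assumes U: "(U, \<phi>) \<in> charts M" "m \<in> U" and V: "(V, \<psi>) \<in> charts M" "m \<in> V"
  shows "linear (dir_deriv (model M) (\<psi> \<circ> inv_into U \<phi>) (\<phi> m))"
  using transition_keller_differentiable[OF U(1) V(1)] U(2) V(2)
  by (auto simp: keller_differentiable_def differentiable_pt_def)

definition base_chart :: "'m \<Rightarrow> 'm set \<times> ('m \<Rightarrow> 'f)" where
  "base_chart m = (SOME c. c \<in> charts M \<and> m \<in> fst c)"

lemma base_chart:
  assumes "m \<in> topspace (mtop M)"
  obtains U \<phi> where "base_chart m = (U, \<phi>)" "(U, \<phi>) \<in> charts M" "m \<in> U"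
proof -
  obtain V \<psi> where "(V, \<psi>) \<in> charts M" "m \<in> V" by (rule chart_at[OF assms])
  then have "\<exists>c. c \<in> charts M \<and> m \<in> fst c" by force
  then have "base_chart m \<in> charts M \<and> m \<in> fst (base_chart m)"
    unfolding base_chart_def by (rule someI_ex)
  then show thesis
    using that by (cases "base_chart m") auto
qed

text \<open>
  The operations are computed in one chosen chart at the base point. As coordinate changes act linearly
  on principal parts, every other chart at that point gives the same result.
\<close>

definition tangent_add :: "(real \<Rightarrow> 'm) set \<Rightarrow> (real \<Rightarrow> 'm) set \<Rightarrow> (real \<Rightarrow> 'm) set" where
  "tangent_add i j = (let \<phi> = snd (base_chart (tangent_proj i)) in
     inv_into (tangent_space (tangent_proj i)) (principal_part \<phi>) (principal_part \<phi> i + principal_part \<phi> j))"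

definition tangent_scale :: "real \<Rightarrow> (real \<Rightarrow> 'm) set \<Rightarrow> (real \<Rightarrow> 'm) set" where
  "tangent_scale a j = (let \<phi> = snd (base_chart (tangent_proj j)) in
     inv_into (tangent_space (tangent_proj j)) (principal_part \<phi>) (a *\<^sub>R principal_part \<phi> j))"

lemma principal_part_tangent_operations:
  assumes U: "(U, \<phi>) \<in> charts M" "m \<in> U" and i: "i \<in> tangent_space m" and j: "j \<in> tangent_space m"
  shows "tangent_add i j \<in> tangent_space m \<and> principal_part \<phi> (tangent_add i j) = principal_part \<phi> i + principal_part \<phi> j"
    and "tangent_scale a i \<in> tangent_space m \<and> principal_part \<phi> (tangent_scale a i) = a *\<^sub>R principal_part \<phi> i"
proof -
  have m: "m \<in> topspace (mtop M)"
    using openin_subset[OF openin_chart[OF U(1)]] U(2) by blast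
  have pi: "tangent_proj i = m" using i by (simp add: fiber_def)
  obtain V \<psi> where b: "base_chart m = (V, \<psi>)" and V: "(V, \<psi>) \<in> charts M" "m \<in> V"
    by (rule base_chart[OF m])
  note inv = principal_part_inv_into[OF V] and change = principal_part_change[OF V U]
    and lin = linear_coordinate_change[OF V U]
  have add: "tangent_add i j = inv_into (tangent_space m) (principal_part \<psi>) (principal_part \<psi> i + principal_part \<psi> j)"
    and scale: "tangent_scale a i = inv_into (tangent_space m) (principal_part \<psi>) (a *\<^sub>R principal_part \<psi> i)"
    by (simp_all add: tangent_add_def tangent_scale_def pi b)
  show "tangent_add i j \<in> tangent_space m \<and> principal_part \<phi> (tangent_add i j) = principal_part \<phi> i + principal_part \<phi> j"
    unfolding add change[OF inv(1)] inv(2) change[OF i] change[OF j] linear_add[OF lin]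
    using inv(1) by simp
  show "tangent_scale a i \<in> tangent_space m \<and> principal_part \<phi> (tangent_scale a i) = a *\<^sub>R principal_part \<phi> i"
    unfolding scale change[OF inv(1)] inv(2) change[OF i] linear_scale[OF lin]
    using inv(1) by simp
qed

lemma linear_between_principal_part:
  assumes "(U, \<phi>) \<in> charts M" "m \<in> U"
  shows "linear_between (tangent_space m) tangent_add tangent_scale (principal_part \<phi>)"
  using principal_part_tangent_operations[OF assms] by (simp add: linear_between_def)

text \<open>
  The metric pulled back along a velocity coordinate induces the topology of the total space on the
  fiber, because that same coordinate is a homeomorphism onto the model for both topologies.
\<close>

lemma frechet_tangent_space:
  assumes m: "m \<in> topspace (mtop M)"
  shows "\<exists>z \<rho>. frechet_on tangent_add z tangent_scale \<rho> \<and>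
    mtopology_of \<rho> = subtopology tangent_top (tangent_space m) \<and>
    (\<exists>\<psi>. linear_between (tangent_space m) tangent_add tangent_scale \<psi> \<and>
       homeomorphic_map (mtopology_of \<rho>) model_top \<psi>)"
proof -
  obtain U \<phi> where U: "(U, \<phi>) \<in> charts M" "m \<in> U"
    by (rule chart_at[OF m])
  obtain \<rho> z where \<rho>: "frechet_on tangent_add z tangent_scale \<rho>" "mspace \<rho> = tangent_space m"
    "homeomorphic_map (mtopology_of \<rho>) model_top (principal_part \<phi>)"
    by (rule frechet_on_transport[OF frechet_model bij_betw_principal_part[OF U]
          principal_part_tangent_operations(1)[OF U] principal_part_tangent_operations(2)[OF U]])
  have "mtopology_of \<rho> = subtopology tangent_top (tangent_space m)"
    by (rule topology_eq_homeomorphic_map[OF \<rho>(3) homeomorphic_map_principal_part[OF U]])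
      (simp only: topspace_tangent_space topspace_mtopology_of \<rho>(2))
  then show ?thesis
    using \<rho>(1,3) linear_between_principal_part[OF U] by blast
qed

section \<open>Changes of trivialization\<close>

abbreviation tangent_transition :: "('m \<Rightarrow> 'f) \<Rightarrow> ('m \<Rightarrow> 'f) \<Rightarrow> 'm \<Rightarrow> 'f \<Rightarrow> 'f" where
  "tangent_transition \<phi> \<psi> \<equiv> transition (tangent_mfld k M) tangent_proj (principal_part \<phi>) (principal_part \<psi>)"

text \<open>
  The transition functions are the derivatives of the coordinate changes, so their joint continuity is
  part of Keller differentiability.
\<close>

lemma tangent_transition_eq:
  assumes U: "(U, \<phi>) \<in> charts M" "m \<in> U" and V: "(V, \<psi>) \<in> charts M" "m \<in> V"
  shows "tangent_transition \<phi> \<psi> m v = dir_deriv (model M) (\<phi> \<circ> inv_into V \<psi>) (\<psi> m) v"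
  unfolding transition_def principal_part_change[OF V U principal_part_inv_into(1)[OF V]]
    principal_part_inv_into(2)[OF V] ..

lemma tangent_transition_inverse:
  assumes U: "(U, \<phi>) \<in> charts M" "m \<in> U" and V: "(V, \<psi>) \<in> charts M" "m \<in> V"
  shows "tangent_transition \<phi> \<psi> m (tangent_transition \<psi> \<phi> m v) = v"
proof -
  let ?j = "inv_into (tangent_space m) (principal_part \<phi>) v"
  have "inv_into (tangent_space m) (principal_part \<psi>) (principal_part \<psi> ?j) = ?j"
    using bij_betw_principal_part[OF V] principal_part_inv_into(1)[OF U]
    by (simp add: bij_betw_def)
  then show ?thesis
    by (simp add: transition_def principal_part_inv_into(2)[OF U])
qed

lemma tangent_transition_GL:
  assumes U: "(U, \<phi>) \<in> charts M" "m \<in> U" and V: "(V, \<psi>) \<in> charts M" "m \<in> V"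
  shows "tangent_transition \<phi> \<psi> m \<in> GL (model M)"
proof -
  have "linear (tangent_transition \<phi> \<psi> m)"
    using linear_coordinate_change[OF V U] by (simp only: tangent_transition_eq[OF U V, abs_def])
  moreover have "homeomorphic_maps (subtopology tangent_top (tangent_space m)) model_top (principal_part \<psi>)
      (inv_into (tangent_space m) (principal_part \<psi>))"
    using homeomorphic_maps_inv_into[OF homeomorphic_map_principal_part[OF V]]
    by (simp only: topspace_tangent_space)
  then have "homeomorphic_map model_top (subtopology tangent_top (tangent_space m))
      (inv_into (tangent_space m) (principal_part \<psi>))"
    by (simp only: homeomorphic_maps_map)
  from homeomorphic_map_compose[OF this homeomorphic_map_principal_part[OF U]]
  have "homeomorphic_map model_top model_top (tangent_transition \<phi> \<psi> m)"
    by (simp add: transition_def[abs_def] o_def)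
  ultimately show ?thesis
    by (simp add: GL_def)
qed

lemma continuous_tangent_transition:
  assumes U: "(U, \<phi>) \<in> charts M" and V: "(V, \<psi>) \<in> charts M"
  shows "continuous_map (prod_topology (subtopology (mtop M) (U \<inter> V)) model_top) model_top
    (\<lambda>(x, v). tangent_transition \<phi> \<psi> x v)"
proof -
  let ?D = "\<lambda>(x, v). dir_deriv (model M) (\<phi> \<circ> inv_into V \<psi>) x v"
  have "continuous_map (subtopology (mtop M) V) model_top \<psi>"
    using homeomorphic_imp_continuous_map[OF homeomorphic_map_chart[OF V]]
    by (simp add: continuous_map_in_subtopology)
  then have "continuous_map (subtopology (mtop M) (U \<inter> V)) model_top \<psi>"
    by (rule continuous_map_from_subtopology_mono) blast
  then have "continuous_map (subtopology (mtop M) (U \<inter> V)) (subtopology model_top (\<psi> ` (V \<inter> U))) \<psi>"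
    by (auto simp: continuous_map_in_subtopology)
  from continuous_map_compose[OF continuous_map_fst this]
  have "continuous_map (prod_topology (subtopology (mtop M) (U \<inter> V)) model_top)
      (prod_topology (subtopology model_top (\<psi> ` (V \<inter> U))) model_top) (\<lambda>z. (\<psi> (fst z), snd z))"
    by (intro continuous_map_pairedI continuous_map_snd) (simp add: o_def)
  moreover have "continuous_map (prod_topology (subtopology model_top (\<psi> ` (V \<inter> U))) model_top) model_top ?D"
    using transition_keller_differentiable[OF V U] by (simp only: keller_differentiable_def)
  ultimately have "continuous_map (prod_topology (subtopology (mtop M) (U \<inter> V)) model_top) model_top
      (?D \<circ> (\<lambda>z. (\<psi> (fst z), snd z)))"
    by (rule continuous_map_compose)
  then show ?thesis
  proof (rule continuous_map_eq)
    fix z assume "z \<in> topspace (prod_topology (subtopology (mtop M) (U \<inter> V)) model_top)"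
    then have "fst z \<in> U" "fst z \<in> V" by auto
    then show "(?D \<circ> (\<lambda>z. (\<psi> (fst z), snd z))) z = (\<lambda>(x, v). tangent_transition \<phi> \<psi> x v) z"
      using tangent_transition_eq[OF U _ V] by (simp add: case_prod_unfold)
  qed
qed

lemma MC_map_tangent_transition:
  assumes U: "(U, \<phi>) \<in> charts M" and V: "(V, \<psi>) \<in> charts M"
  shows "MC_map 0 (times_mfld (open_submfld M (U \<inter> V)) (model M)) (vec_mfld (max_metric (model M) (model M)))
    (\<lambda>(x, v). (tangent_transition \<phi> \<psi> x v, inv (tangent_transition \<phi> \<psi> x) v))"
proof (rule MC_map_0I)
  show "topological_charts (times_mfld (open_submfld M (U \<inter> V)) (model M))"
    using openin_chart[OF U] openin_chart[OF V]
    by (intro topological_charts_times_mfld topological_charts_open_submfld topological_charts_base) auto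
  show "topological_charts (vec_mfld (max_metric (model M) (model M)))"
    by (rule topological_charts_vec_mfld) simp
  have "continuous_map (prod_topology (subtopology (mtop M) (U \<inter> V)) model_top) (prod_topology model_top model_top)
      (\<lambda>z. ((\<lambda>(x, v). tangent_transition \<phi> \<psi> x v) z, (\<lambda>(x, v). tangent_transition \<psi> \<phi> x v) z))"
    using continuous_tangent_transition[OF U V] continuous_tangent_transition[OF V U]
    by (intro continuous_map_pairedI) (simp_all only: Int_commute[of V U])
  then have "continuous_map (prod_topology (subtopology (mtop M) (U \<inter> V)) model_top) (prod_topology model_top model_top)
      (\<lambda>(x, v). (tangent_transition \<phi> \<psi> x v, inv (tangent_transition \<phi> \<psi> x) v))"
  proof (rule continuous_map_eq)
    fix z assume "z \<in> topspace (prod_topology (subtopology (mtop M) (U \<inter> V)) model_top)"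
    then have z: "fst z \<in> U" "fst z \<in> V" by auto
    have "inv (tangent_transition \<phi> \<psi> (fst z)) = tangent_transition \<psi> \<phi> (fst z)"
      by (rule inv_equality) (rule tangent_transition_inverse[OF V z(2) U z(1)] tangent_transition_inverse[OF U z(1) V z(2)])+
    then show "((\<lambda>(x, v). tangent_transition \<phi> \<psi> x v) z, (\<lambda>(x, v). tangent_transition \<psi> \<phi> x v) z) =
        (\<lambda>(x, v). (tangent_transition \<phi> \<psi> x v, inv (tangent_transition \<phi> \<psi> x) v)) z"
      by (simp add: case_prod_unfold)
  qed
  then show "continuous_map (mtop (times_mfld (open_submfld M (U \<inter> V)) (model M)))
      (mtop (vec_mfld (max_metric (model M) (model M))))
      (\<lambda>(x, v). (tangent_transition \<phi> \<psi> x v, inv (tangent_transition \<phi> \<psi> x) v))"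
    by (simp add: times_mfld_def open_submfld_def vec_mfld_def mtopology_of_max_metric)
qed

lemma MC_diffeo_trivialization:
  assumes U: "(U, \<phi>) \<in> charts M"
  shows "MC_diffeo 0 (open_submfld (tangent_mfld k M) {j \<in> topspace tangent_top. tangent_proj j \<in> U})
    (times_mfld (open_submfld M U) (model M)) (\<lambda>j. (tangent_proj j, principal_part \<phi> j))"
proof -
  have over: "{j \<in> topspace tangent_top. tangent_proj j \<in> U} = tangent_over k M U"
    by (simp add: tangent_over_def)
  obtain g where "homeomorphic_maps (subtopology tangent_top (tangent_over k M U))
      (prod_topology (subtopology (mtop M) U) model_top) (\<lambda>j. (tangent_proj j, principal_part \<phi> j)) g"
    using homeomorphic_map_trivialization[OF U] unfolding homeomorphic_map_maps by (elim exE)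
  then have g: "continuous_map (subtopology tangent_top (tangent_over k M U))
        (prod_topology (subtopology (mtop M) U) model_top) (\<lambda>j. (tangent_proj j, principal_part \<phi> j))"
      "continuous_map (prod_topology (subtopology (mtop M) U) model_top)
        (subtopology tangent_top (tangent_over k M U)) g"
      "\<forall>j\<in>topspace (subtopology tangent_top (tangent_over k M U)). g (tangent_proj j, principal_part \<phi> j) = j"
      "\<forall>z\<in>topspace (prod_topology (subtopology (mtop M) U) model_top).
        (tangent_proj (g z), principal_part \<phi> (g z)) = z"
    unfolding homeomorphic_maps_def by blast+
  have c1: "topological_charts (open_submfld (tangent_mfld k M) (tangent_over k M U))"
    by (intro topological_charts_open_submfld topological_charts_tangent openin_tangent_over[OF U])
  have c2: "topological_charts (times_mfld (open_submfld M U) (model M))"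
    by (intro topological_charts_times_mfld topological_charts_open_submfld topological_charts_base
        openin_chart[OF U] mspace_model)
  have t: "mtop (open_submfld (tangent_mfld k M) (tangent_over k M U)) = subtopology tangent_top (tangent_over k M U)"
    "mtop (times_mfld (open_submfld M U) (model M)) = prod_topology (subtopology (mtop M) U) model_top"
    by (simp_all add: open_submfld_def times_mfld_def)
  show ?thesis
    unfolding over MC_diffeo_def
    by (intro conjI exI[of _ g] MC_map_0I[OF c1 c2] MC_map_0I[OF c2 c1]; unfold t; fact g)
qed

lemma tangent_bundle:
  "MC_vector_bundle 0 M (tangent_mfld k M) tangent_proj (model M) tangent_add tangent_scale
     ((\<lambda>(U, \<phi>). (U, principal_part \<phi>)) ` charts M)"
  unfolding MC_vector_bundle_def
proof (intro conjI)
  show "frechet (model M)" by (rule frechet_model)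
  show "MC_manifold 0 M" by (rule MC_manifold_0_base)
  show "MC_manifold 0 (tangent_mfld k M)" by (rule MC_manifold_0_tangent)
  show "MC_map 0 (tangent_mfld k M) M tangent_proj"
    by (rule MC_map_0I[OF topological_charts_tangent topological_charts_base continuous_tangent_proj])
  show "\<forall>m\<in>topspace (mtop M). \<exists>z \<rho>. frechet_on tangent_add z tangent_scale \<rho> \<and>
      mtopology_of \<rho> = subtopology tangent_top (tangent_space m) \<and>
      (\<exists>\<psi>. linear_between (tangent_space m) tangent_add tangent_scale \<psi> \<and>
         homeomorphic_map (mtopology_of \<rho>) model_top \<psi>)"
    by (intro ballI frechet_tangent_space)
  show "\<forall>m\<in>topspace (mtop M). \<exists>(U, \<psi>)\<in>(\<lambda>(U, \<phi>). (U, principal_part \<phi>)) ` charts M. m \<in> U"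
  proof
    fix m assume "m \<in> topspace (mtop M)"
    then obtain U \<phi> where "(U, \<phi>) \<in> charts M" "m \<in> U" by (rule chart_at)
    then show "\<exists>(U, \<psi>)\<in>(\<lambda>(U, \<phi>). (U, principal_part \<phi>)) ` charts M. m \<in> U" by force
  qed
  show "\<forall>(U, \<psi>)\<in>(\<lambda>(U, \<phi>). (U, principal_part \<phi>)) ` charts M. openin (mtop M) U \<and>
      MC_diffeo 0 (open_submfld (tangent_mfld k M) {v \<in> topspace tangent_top. tangent_proj v \<in> U})
        (times_mfld (open_submfld M U) (model M)) (\<lambda>v. (tangent_proj v, \<psi> v)) \<and>
      (\<forall>m\<in>U. linear_between (tangent_space m) tangent_add tangent_scale \<psi>)"
    using openin_chart MC_diffeo_trivialization linear_between_principal_part by fastforce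
  show "\<forall>(U, \<psi>)\<in>(\<lambda>(U, \<phi>). (U, principal_part \<phi>)) ` charts M.
      \<forall>(U', \<psi>')\<in>(\<lambda>(U, \<phi>). (U, principal_part \<phi>)) ` charts M.
        (\<forall>x\<in>U \<inter> U'. transition (tangent_mfld k M) tangent_proj \<psi> \<psi>' x \<in> GL (model M)) \<and>
        MC_map 0 (times_mfld (open_submfld M (U \<inter> U')) (model M)) (vec_mfld (max_metric (model M) (model M)))
          (\<lambda>(x, v). (transition (tangent_mfld k M) tangent_proj \<psi> \<psi>' x v,
             inv (transition (tangent_mfld k M) tangent_proj \<psi> \<psi>' x) v))"
    using MC_map_tangent_transition tangent_transition_GL by fastforce
qed

end

theorem theorem3p1:
  fixes k :: enat
    and M :: "('m, 'f::real_vector) mfld"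
    and F :: "'f metric"
  assumes "k \<ge> 1"
    and "frechet F"
    and "MC_manifold k M"
    and "model M = F"
    and "has_tangent_charts k M"
  shows "\<exists>(r::enat) add smul T.
    MC_vector_bundle r M (tangent_mfld k M) tangent_proj F add smul T"
proof -
  interpret tangent_atlas k M
    by unfold_locales (fact assms)+
  show ?thesis
    using tangent_bundle assms(4) by blast
qed

end
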